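(* Let $X$ be a symmetric real random variable with variance $\sigma^2\in(0,\infty)$, and suppose there are $\alpha\in(2,3)$, $c_0>0$ and a function $\varepsilon$ with $\varepsilon(x)\to 0$ as $x\to\infty$ such that $P(|X|>x)=c_0x^{-\alpha}(1+\varepsilon(x))$. Let $X_1,X_2,\dots$ be i.i.d. copies of $X$, let $Z_n=\frac{1}{\sigma\sqrt n}\sum_{i=1}^n (X_i-\mu)$ with $\mu=\mathbb{E}X_1$, and let $F_n(t)=P(Z_n\le t)$. Let $h$ be a regular exhaustion function. Then for every $q>0$ and every $\delta\in(0,\alpha-2)$ there are constants $c>0$ and $C_\delta<\infty$, not depending on $n$, such that for all $n\ge 1$ $$c\,n^{-(\alpha-2)/2}\ \le\ d_{K,h,q}\big(\mathcal{L}(Z_n),\Phi\big)\ \le\ \sup_{t\in\mathbb{R}}|F_n(t)-\Phi(t)|\ \le\ C_\delta\,n^{-\delta/2},$$ so that both $d_{K,h,q}(\mathcal{L}(Z_n),\Phi)$ and $\sup_t|F_n(t)-\Phi(t)|$ are equal to $n^{-(\alpha-2)/2+o(1)}$ as $n\to\infty$. In particular: (i) for every choice of a regular exhaustion function $h$ and of $q>0$, $d_{K,h,q}(\mathcal{L}(Z_n),\Phi)$ is not $O(n^{-1/2})$; and, more generally, for every Borel weight $w:\mathbb{R}\to(0,1]$ such that $w(x)\ge C_w^{-1}(1+|x|)^{-m}$ for all $x\in\mathbb{R}$, for some constants $C_w>0$ and $m<\infty$, the quantity $\sup_t w(t)|F_n(t)-\Phi(t)|$ is not $O(n^{-1/2})$;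 (ii) if $X$ has the Student-$t$ distribution with $\nu=2.5$ degrees of freedom, then both $d_{K,h,q}(\mathcal{L}(Z_n),\Phi)$ and $\sup_t|F_n(t)-\Phi(t)|$ are equal to $n^{-1/4+o(1)}$ as $n\to\infty$.
   Context: $\Phi$ denotes the standard normal cumulative distribution function, and $\mathcal{L}(Z_n)$ is the law of $Z_n$ (identified with its cdf $F_n$). A random variable $X$ is symmetric if $X$ and $-X$ have the same law (so $\mu=0$). A regular exhaustion function is a function $h:\mathbb{R}\to[0,\infty)$ that is Borel and locally bounded, satisfies $h(t)\to\infty$ as $|t|\to\infty$, and for which there are $c_1,c_2>0$ and $t_0\ge 0$ with $c_1|t|\le h(t)\le c_2|t|$ for all $|t|\ge t_0$. For cdfs $F,G$ and $q>0$, the weighted Kolmogorov metric is $d_{K,h,q}(F,G)=\sup_{t\in\mathbb{R}}(1+h(t))^{-q}|F(t)-G(t)|$. A positive sequence $a_n$ equals $n^{-r+o(1)}$ if $\log a_n/\log n\to -r$ as $n\to\infty$. *)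

theory Defs
  imports "HOL-Probability.Probability" "HOL-Library.Landau_Symbols"
begin

definition symmetric_rv :: "'a measure \<Rightarrow> ('a \<Rightarrow> real) \<Rightarrow> bool" where
  "symmetric_rv P X \<longleftrightarrow> distr P borel X = distr P borel (\<lambda>\<omega>. - X \<omega>)"

definition regular_exhaustion :: "(real \<Rightarrow> real) \<Rightarrow> bool" where
  "regular_exhaustion h \<longleftrightarrow>
     h \<in> borel_measurable borel \<and> (\<forall>t. 0 \<le> h t) \<and>
     (\<forall>K. compact K \<longrightarrow> bounded (h ` K)) \<and>
     filterlim h at_top at_infinity \<and>
     (\<exists>c1>0. \<exists>c2>0. \<exists>t0\<ge>0. \<forall>t. t0 \<le> \<bar>t\<bar> \<longrightarrow> c1 * \<bar>t\<bar> \<le> h t \<and> h t \<le> c2 * \<bar>t\<bar>)"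

text \<open>
  The suprema below are real-valued. They are genuine suprema whenever \<open>F\<close> and \<open>G\<close> are cdfs and
  the weights lie in \<open>(0, 1]\<close>, since the family is then bounded by 1.
\<close>

definition weighted_sup_dist :: "(real \<Rightarrow> real) \<Rightarrow> (real \<Rightarrow> real) \<Rightarrow> (real \<Rightarrow> real) \<Rightarrow> real" where
  "weighted_sup_dist w F G = (SUP t. w t * \<bar>F t - G t\<bar>)"

definition kolmogorov_dist :: "(real \<Rightarrow> real) \<Rightarrow> (real \<Rightarrow> real) \<Rightarrow> real" where
  "kolmogorov_dist F G = (SUP t. \<bar>F t - G t\<bar>)"

definition weighted_kolmogorov_dist ::
    "(real \<Rightarrow> real) \<Rightarrow> real \<Rightarrow> (real \<Rightarrow> real) \<Rightarrow> (real \<Rightarrow> real) \<Rightarrow> real" where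
  "weighted_kolmogorov_dist h q = weighted_sup_dist (\<lambda>t. (1 + h t) powr (- q))"

definition poly_bounded_weight :: "(real \<Rightarrow> real) \<Rightarrow> bool" where
  "poly_bounded_weight w \<longleftrightarrow>
     w \<in> borel_measurable borel \<and> (\<forall>x. 0 < w x \<and> w x \<le> 1) \<and>
     (\<exists>C>0. \<exists>m. \<forall>x. inverse C * (1 + \<bar>x\<bar>) powr (- m) \<le> w x)"

definition std_normal_cdf :: "real \<Rightarrow> real" where
  "std_normal_cdf = cdf std_normal_distribution"

definition standardized_sum :: "real \<Rightarrow> real \<Rightarrow> (nat \<Rightarrow> 'a \<Rightarrow> real) \<Rightarrow> nat \<Rightarrow> 'a \<Rightarrow> real" where
  "standardized_sum \<mu> \<sigma> Xs n \<omega> = 1 / (\<sigma> * sqrt (real n)) * (\<Sum>i=1..n. (Xs i \<omega> - \<mu>))"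

text \<open>\<open>a\<^sub>n = n\<^sup>-\<^sup>r\<^sup>+\<^sup>o\<^sup>(\<^sup>1\<^sup>)\<close>, for a sequence indexed by \<open>n \<ge> 1\<close>.\<close>

definition power_rate :: "(nat \<Rightarrow> real) \<Rightarrow> real \<Rightarrow> bool" where
  "power_rate a r \<longleftrightarrow>
     (\<forall>n\<ge>1. 0 < a n) \<and> (\<lambda>n. ln (a n) / ln (real n)) \<longlonglongrightarrow> - r"

definition student_t_density :: "real \<Rightarrow> real \<Rightarrow> real" where
  "student_t_density \<nu> x =
     Gamma ((\<nu> + 1) / 2) / (sqrt (\<nu> * pi) * Gamma (\<nu> / 2)) * (1 + x\<^sup>2 / \<nu>) powr (- ((\<nu> + 1) / 2))"

end

theory Submission
  imports Defs "HOL-Real_Asymp.Real_Asymp"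
begin

text \<open>
  Write \<open>v\<close> for the variance and \<open>f s = E (cos (s X))\<close> for the characteristic function, which is real
  by symmetry. Since \<open>E X\<^sup>2\<close> is finite, \<open>f s - exp (- v s\<^sup>2 / 2)\<close> is governed near \<open>0\<close> by
  \<open>E (cos (s X) - 1 + (s X)\<^sup>2 / 2)\<close>. This has a nonnegative integrand that is at least \<open>1\<close> on
  \<open>\<bar>X\<bar> > 3 / \<bar>s\<bar>\<close>, so it is at least a multiple of \<open>\<bar>s\<bar> powr \<alpha>\<close>, and it is at most
  \<open>E \<bar>X\<bar> powr (2 + \<delta>)\<close> times \<open>\<bar>s\<bar> powr (2 + \<delta>)\<close>.

  Upper bound: smooth both laws with an independent centred normal variable of standard deviation
  \<open>e = n powr (- \<delta> / 2)\<close>. This changes the Kolmogorov distance by at most a constant factor and an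
  error \<open>O(e)\<close>, and it makes the characteristic functions negligible beyond frequency \<open>sqrt n\<close>
  because \<open>\<delta> < 1\<close>; hence Levy's inversion formula applies without a compactly supported kernel.

  Lower bound: integrating by parts against \<open>exp (- x\<^sup>2 / 2)\<close>, which is itself a characteristic
  function, the integral of \<open>x exp (- x\<^sup>2 / 2) (F\<^sub>n x - \<Phi> x)\<close> equals the expectation of
  \<open>f (N / sqrt (v n)) ^ n - exp (- N\<^sup>2 / 2)\<close> for a standard normal \<open>N\<close>. The integrand is nonnegative for
  \<open>\<bar>N\<bar> \<le> r sqrt n\<close> and at least a multiple of \<open>n powr (- (\<alpha> - 2) / 2)\<close> on compact sets
  avoiding \<open>0\<close>, whereas the remaining range contributes only \<open>O(1 / n)\<close>. The Gaussian factor
  absorbs any polynomial weight.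
\<close>

section \<open>Levy inversion bound and Gaussian smoothing\<close>

text \<open>Levy's inversion formula for both laws on \<open>{a<..b}\<close>: the factor
  \<open>\<bar>t\<bar>\<close> in the hypothesis cancels the pole of the kernel at \<open>0\<close>,
  so the estimate depends neither on the interval nor on the cutoff \<open>T\<close>. The factor
  \<open>1 / pi\<close> is \<open>2 / (2 * pi)\<close>.\<close>

lemma cdf_diff_le_char:
  fixes g :: "real \<Rightarrow> real"
  assumes "real_distribution A" and "real_distribution B"
    and noatom: "\<And>x. measure A {x} = 0" "\<And>x. measure B {x} = 0"
    and g: "integrable lborel g" "\<And>t. 0 \<le> g t"
    and le: "\<And>t. cmod (char A t - char B t) \<le> \<bar>t\<bar> * g t"
  shows "\<bar>cdf A b - cdf B b\<bar> \<le> (1 / pi) * (LINT t|lborel. g t)"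
proof -
  interpret A: real_distribution A by fact
  interpret B: real_distribution B by fact
  define F where "F a t = (iexp (-(t * a)) - iexp (-(t * b))) / (\<i> * t)" for a t :: real
  define I where "I a T \<phi> = 1 / (2 * pi) * (CLBINT t=-real T..real T. F a t * \<phi> t)" for a T and \<phi> :: "real \<Rightarrow> complex"
  \<comment> \<open>Two bounds on the kernel: \<open>b - a\<close> makes each truncated integral
    exist, but grows with the interval; \<open>2 / \<bar>t\<bar>\<close> is uniform in
    \<open>a\<close> and serves for the difference of the two integrals.\<close>
  have Fbound: "cmod (F a t) \<le> b - a" if "a \<le> b" for a t
  proof (cases "t = 0")
    case False
    then show ?thesis
      using Levy_Inversion_aux2[of "-b" "-a" t] that by (simp add: F_def)
  qed (use that in \<open>simp add: F_def\<close>)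
  have Fbound2: "cmod (F a t) \<le> 2 / \<bar>t\<bar>" for a t
  proof (cases "t = 0")
    case False
    have "cmod (iexp (-(t * a)) - iexp (-(t * b))) \<le> 2"
      using norm_triangle_ineq4[of "iexp (-(t * a))" "iexp (-(t * b))"]
      by (simp add: norm_exp_i_times del: of_real_minus of_real_mult)
    then show ?thesis using False
      by (simp add: F_def norm_divide norm_mult divide_right_mono del: of_real_minus of_real_mult)
  qed (simp add: F_def)
  have Fmeas [measurable]: "F a \<in> borel_measurable borel" for a
    unfolding F_def by measurable
  have int: "integrable lborel (\<lambda>t. indicator {-real T<..<real T} t *\<^sub>R (F a t * char D t))"
    if "a \<le> b" "real_distribution D" for a T D
  proof (rule integrableI_bounded_set_indicator[where B="b - a"])
    interpret D: real_distribution D by fact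
    have "cmod (F a t * char D t) \<le> (b - a) * 1" for t
      unfolding norm_mult by (intro mult_mono Fbound that D.cmod_char_le_1) (use that in auto)
    then show "AE x in lborel. x \<in> {- real T<..<real T} \<longrightarrow> cmod (F a x * char D x) \<le> b - a" by simp
    show "(\<lambda>x. F a x * char D x) \<in> borel_measurable lborel" by measurable
  qed (auto simp: ennreal_less_top)
  have Ieq: "I a T \<phi> = 1 / (2 * pi) * (CLBINT t. indicator {-real T<..<real T} t *\<^sub>R (F a t * \<phi> t))" for a T \<phi>
    by (simp add: I_def interval_lebesgue_integral_def set_lebesgue_integral_def)
  have norm_scale: "cmod (of_real (1 / (2*pi)) * z) = 1 / (2*pi) * cmod z" for z
    by (simp add: norm_mult norm_divide)
  have Ibound: "cmod (I a T (char A) - I a T (char B)) \<le> (1 / pi) * (LINT t|lborel. g t)" if "a \<le> b" for a T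
  proof -
    let ?i = "\<lambda>D t. indicator {-real T<..<real T} t *\<^sub>R (F a t * char D t)"
    have Idiff: "I a T (char A) - I a T (char B) = 1 / (2*pi) * (CLBINT t. ?i A t - ?i B t)"
      unfolding Ieq right_diff_distrib[symmetric]
      by (subst Bochner_Integration.integral_diff) (rule int that assms(1,2) refl)+
    have e1: "cmod (I a T (char A) - I a T (char B)) = 1 / (2*pi) * cmod (CLBINT t. ?i A t - ?i B t)"
      unfolding Idiff by (rule norm_scale)
    have e2: "cmod (CLBINT t. ?i A t - ?i B t) \<le> (LINT t|lborel. 2 * g t)"
    proof (rule Bochner_Integration.integral_norm_bound_integral)
      fix t :: real
      have "cmod (F a t * (char A t - char B t)) \<le> 2 / \<bar>t\<bar> * (\<bar>t\<bar> * g t)"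
        unfolding norm_mult by (rule mult_mono[OF Fbound2 le]) auto
      also have "\<dots> \<le> 2 * g t" using g(2)[of t] by (cases "t = 0") auto
      finally show "cmod (?i A t - ?i B t) \<le> 2 * g t"
        using g(2)[of t] by (auto simp: indicator_def algebra_simps)
    qed (intro Bochner_Integration.integrable_diff int that assms(1,2), use g(1) in simp)
    show ?thesis unfolding e1 using mult_left_mono[OF e2, of "1 / (2*pi)"] by simp
  qed
  have diff: "\<bar>measure A {a<..b} - measure B {a<..b}\<bar> \<le> (1 / pi) * (LINT t|lborel. g t)" if "a \<le> b" for a
  proof -
    have "(\<lambda>T. I a T (char A) - I a T (char B)) \<longlonglongrightarrow> of_real (measure A {a<..b}) - of_real (measure B {a<..b})"
      unfolding I_def F_def
      using A.Levy_Inversion[OF that noatom(1) noatom(1)] B.Levy_Inversion[OF that noatom(2) noatom(2)]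
      by (intro tendsto_diff) simp_all
    then have "(\<lambda>T. cmod (I a T (char A) - I a T (char B))) \<longlonglongrightarrow> cmod (of_real (measure A {a<..b}) - of_real (measure B {a<..b}))"
      by (rule tendsto_norm)
    then have "cmod (of_real (measure A {a<..b}) - of_real (measure B {a<..b})) \<le> (1 / pi) * (LINT t|lborel. g t)"
      by (rule LIMSEQ_le_const2) (use Ibound[OF that] in blast)
    then show ?thesis by (simp del: of_real_diff add: of_real_diff[symmetric])
  qed
  \<comment> \<open>Both cdfs vanish as \<open>a\<close> tends to \<open>at_bot\<close>, and the
    bound for \<open>{a<..b}\<close> is free of \<open>a\<close>.\<close>
  have "((\<lambda>a. \<bar>(cdf A b - cdf A a) - (cdf B b - cdf B a)\<bar>) \<longlongrightarrow> \<bar>(cdf A b - 0) - (cdf B b - 0)\<bar>) at_bot"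
    by (intro tendsto_intros A.cdf_lim_at_bot B.cdf_lim_at_bot)
  moreover have "\<forall>\<^sub>F a in at_bot. \<bar>(cdf A b - cdf A a) - (cdf B b - cdf B a)\<bar> \<le> (1 / pi) * (LINT t|lborel. g t)"
    using eventually_gt_at_bot[of b] eventually_le_at_bot[of "b - 1"]
  proof eventually_elim
    case (elim a)
    then show ?case using diff[of a] by (simp add: A.cdf_diff_eq B.cdf_diff_eq)
  qed
  ultimately have "\<bar>(cdf A b - 0) - (cdf B b - 0)\<bar> \<le> (1 / pi) * (LINT t|lborel. g t)"
    by (rule tendsto_upperbound) simp
  then show ?thesis by simp
qed

section \<open>Convolution with a centred normal law\<close>

text \<open>The convolution of \<open>W\<close> with a normal law of standard deviation
  \<open>\<bar>e\<bar>\<close>, realised on a product space so that Fubini applies in either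
  variable.\<close>

definition gauss_smooth :: "real measure \<Rightarrow> real \<Rightarrow> real measure" where
  "gauss_smooth W e = distr (W \<Otimes>\<^sub>M std_normal_distribution) borel (\<lambda>(x, y). x + e * y)"

context real_distribution begin

lemma pair_gauss: "pair_prob_space M std_normal_distribution"
  unfolding pair_prob_space_def pair_sigma_finite_def
  using real_dist_normal_dist by (simp add: prob_space_axioms prob_space_imp_sigma_finite real_distribution_def)

lemma sets_pair_gauss [measurable_cong]: "sets (M \<Otimes>\<^sub>M std_normal_distribution) = sets (borel \<Otimes>\<^sub>M borel)"
  by (intro sets_pair_measure_cong) auto

lemma real_distribution_gauss_smooth: "real_distribution (gauss_smooth M e)"
proof -
  interpret pair_prob_space M std_normal_distribution by (rule pair_gauss)
  show ?thesis unfolding gauss_smooth_def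
    by (rule P.real_distribution_distr) measurable
qed

lemma char_gauss_smooth: "char (gauss_smooth M e) t = char M t * exp (- ((e * t)^2) / 2)"
proof -
  interpret pair_prob_space M std_normal_distribution by (rule pair_gauss)
  have "char (gauss_smooth M e) t = (CLINT z|(M \<Otimes>\<^sub>M std_normal_distribution). (case z of (x, y) \<Rightarrow> iexp (t * x) * iexp (e * t * y)))"
    unfolding char_def gauss_smooth_def
    by (subst integral_distr) (auto simp: exp_add[symmetric] algebra_simps split_beta' intro!: Bochner_Integration.integral_cong)
  also have "\<dots> = (CLINT x|M. (CLINT y|std_normal_distribution. iexp (t * x) * iexp (e * t * y)))"
    by (subst integral_fst'[symmetric])
      (auto intro!: P.integrable_const_bound[of _ 1] simp: norm_mult split_beta' simp del: of_real_mult)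
  also have "\<dots> = (CLINT x|M. iexp (t * x) * char std_normal_distribution (e * t))"
    unfolding char_def by simp
  also have "\<dots> = char M t * char std_normal_distribution (e * t)"
    unfolding char_def by simp
  finally show ?thesis by (simp add: char_std_normal_distribution)
qed

text \<open>Fubini in both orders. The first form expresses the smoothed cdf as a normal average of
  shifted cdfs, the second shows that smoothing removes atoms.\<close>

lemma measure_gauss_smooth:
  assumes [measurable]: "S \<in> sets borel"
  shows "measure (gauss_smooth M e) S = (LINT y|std_normal_distribution. measure M ((\<lambda>x. x + e * y) -` S))"
    (is ?A)
  and "measure (gauss_smooth M e) S = (LINT x|M. measure std_normal_distribution ((\<lambda>y. x + e * y) -` S))"
    (is ?B)
proof -
  interpret pair_prob_space M std_normal_distribution by (rule pair_gauss)
  have sp: "space (M \<Otimes>\<^sub>M std_normal_distribution) = UNIV" by (simp add: space_pair_measure)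
  let ?f = "\<lambda>x y. indicator S (x + e * y) :: real"
  have 0: "measure (gauss_smooth M e) S = integral\<^sup>L (M \<Otimes>\<^sub>M std_normal_distribution) (case_prod ?f)"
  proof -
    interpret S: real_distribution "gauss_smooth M e" by (rule real_distribution_gauss_smooth)
    have "measure (gauss_smooth M e) S = (LINT z|gauss_smooth M e. indicator S z)" by simp
    also have "\<dots> = (LINT z|(M \<Otimes>\<^sub>M std_normal_distribution). indicator S (case z of (x, y) \<Rightarrow> x + e * y))"
      unfolding gauss_smooth_def by (rule integral_distr) measurable
    finally show ?thesis by (simp add: split_beta')
  qed
  have int: "integrable (M \<Otimes>\<^sub>M std_normal_distribution) (case_prod ?f)"
    by (auto intro!: P.integrable_const_bound[of _ 1] simp: split_beta')
  have [measurable]: "(\<lambda>x. x + e * y) -` S \<in> sets borel" "(\<lambda>y. x + e * y) -` S \<in> sets borel" for x y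
    using measurable_sets[of "\<lambda>x. x + e * y" borel borel S] measurable_sets[of "\<lambda>y. x + e * y" borel borel S] by auto
  have "measure (gauss_smooth M e) S = (LINT y|std_normal_distribution. (LINT x|M. ?f x y))"
    unfolding 0 by (rule integral_snd[symmetric, OF int])
  also have "(\<lambda>y. LINT x|M. ?f x y) = (\<lambda>y. measure M ((\<lambda>x. x + e * y) -` S))"
  proof
    fix y
    have "(LINT x|M. ?f x y) = (LINT x|M. indicator ((\<lambda>x. x + e * y) -` S) x)"
      by (intro Bochner_Integration.integral_cong) (auto simp: indicator_def)
    then show "(LINT x|M. ?f x y) = measure M ((\<lambda>x. x + e * y) -` S)" by simp
  qed
  finally show ?A .
  have "measure (gauss_smooth M e) S = (LINT x|M. (LINT y|std_normal_distribution. ?f x y))"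
    unfolding 0 by (rule integral_fst'[symmetric, OF int, simplified])
  also have "(\<lambda>x. LINT y|std_normal_distribution. ?f x y) = (\<lambda>x. measure std_normal_distribution ((\<lambda>y. x + e * y) -` S))"
  proof
    fix x
    have "(LINT y|std_normal_distribution. ?f x y) = (LINT y|std_normal_distribution. indicator ((\<lambda>y. x + e * y) -` S) y)"
      by (intro Bochner_Integration.integral_cong) (auto simp: indicator_def)
    then show "(LINT y|std_normal_distribution. ?f x y) = measure std_normal_distribution ((\<lambda>y. x + e * y) -` S)" by simp
  qed
  finally show ?B .
qed

lemma cdf_gauss_smooth: "cdf (gauss_smooth M e) x = (LINT y|std_normal_distribution. cdf M (x - e * y))"
proof -
  have "(\<lambda>x. x + e * y) -` {..x} = {..x - e * y}" for y by auto
  then show ?thesis unfolding cdf_def by (simp add: measure_gauss_smooth(1))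
qed

end

lemma measure_std_normal_singleton: "measure std_normal_distribution {x} = 0"
proof -
  have "emeasure std_normal_distribution {x} = 0"
    by (subst emeasure_density) (auto simp: nn_integral_cmult_indicator)
  then show ?thesis by (simp add: measure_def)
qed

text \<open>Supplies the absence of atoms required by \<open>cdf_diff_le_char\<close>: for fixed
  \<open>z\<close> the event is a single point of the normal variable.\<close>

lemma (in real_distribution) measure_gauss_smooth_singleton:
  assumes "e \<noteq> 0"
  shows "measure (gauss_smooth M e) {x} = 0"
proof -
  have "(\<lambda>y. z + e * y) -` {x} = {(x - z) / e}" for z
    using assms by (auto simp: field_simps)
  then show ?thesis by (simp add: measure_gauss_smooth(2) measure_std_normal_singleton)
qed

text \<open>The normal density is at most \<open>1 / sqrt (2 * pi)\<close>, which is below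
  \<open>1 / 2\<close> because \<open>pi > 2\<close>.\<close>

lemma std_normal_cdf_diff_le:
  assumes "x \<le> y"
  shows "std_normal_cdf y - std_normal_cdf x \<le> (y - x) / 2"
proof (cases "x = y")
  case False
  interpret N: real_distribution std_normal_distribution by (rule real_dist_normal_dist)
  have dens: "std_normal_density z \<le> 1 / 2" for z
  proof -
    have "2 \<le> sqrt (2 * pi)" using pi_gt3 by (intro real_le_rsqrt) (simp add: power2_eq_square)
    then have "1 / sqrt (2 * pi) * exp (- z\<^sup>2 / 2) \<le> 1 / 2 * 1"
      by (intro mult_mono) (auto simp: field_simps)
    then show ?thesis by (simp add: std_normal_density_def)
  qed
  have "emeasure std_normal_distribution {x<..y} = (\<integral>\<^sup>+z. ennreal (std_normal_density z) * indicator {x<..y} z \<partial>lborel)"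
    by (simp add: emeasure_density)
  also have "\<dots> \<le> (\<integral>\<^sup>+z. ennreal (1/2) * indicator {x<..y} z \<partial>lborel)"
    by (intro nn_integral_mono mult_right_mono ennreal_leI dens) auto
  also have "\<dots> = ennreal ((y - x) / 2)"
    using assms by (simp add: nn_integral_cmult_indicator ennreal_mult'[symmetric] del: ennreal_half)
  finally have "measure std_normal_distribution {x<..y} \<le> (y - x) / 2"
    using assms by (simp add: N.emeasure_eq_measure)
  then show ?thesis
    using False assms N.cdf_diff_eq[of x y] by (simp add: std_normal_cdf_def)
qed simp

text \<open>Chebyshev's inequality with second moment \<open>1\<close>.\<close>

lemma std_normal_tail_le:
  assumes "0 < c"
  shows "measure std_normal_distribution {y. c < \<bar>y\<bar>} \<le> 1 / c\<^sup>2"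
proof -
  interpret N: real_distribution std_normal_distribution by (rule real_dist_normal_dist)
  have i: "integrable std_normal_distribution (\<lambda>y. y\<^sup>2)" "(LINT y|std_normal_distribution. y\<^sup>2) = 1"
    using std_normal_distribution_even_moments[of 1] by auto
  have "measure std_normal_distribution {y. c < \<bar>y\<bar>} = (LINT y|std_normal_distribution. indicator {y. c < \<bar>y\<bar>} y)"
    by simp
  also have "\<dots> \<le> (LINT y|std_normal_distribution. y\<^sup>2 / c\<^sup>2)"
  proof (rule integral_mono)
    show "indicator {y. c < \<bar>y\<bar>} y \<le> y\<^sup>2 / c\<^sup>2" for y
      using assms abs_le_square_iff[of c y] by (auto simp: indicator_def)
    show "integrable std_normal_distribution (indicat_real {y. c < \<bar>y\<bar>})"
      by (rule N.integrable_const_bound[of _ 1]) auto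
  qed (use i(1) in auto)
  also have "\<dots> = 1 / c\<^sup>2" using i by simp
  finally show ?thesis .
qed

text \<open>Shifting by \<open>2 e\<close> puts \<open>z - e y\<close> on one side of the original point for \<open>\<bar>y\<bar> \<le> 2\<close>, an event of
  normal probability at least \<open>3 / 4\<close>; the supremum \<open>\<Delta>\<close> reappears with factor \<open>1 / 3\<close> and is absorbed later.\<close>

lemma gauss_smoothing_aux:
  fixes D :: "real \<Rightarrow> real"
  assumes [measurable]: "D \<in> borel_measurable borel" and \<Delta>: "\<And>y. \<bar>D y\<bar> \<le> \<Delta>"
    and K: "0 \<le> K" "\<And>y. \<bar>y\<bar> \<le> 2 \<Longrightarrow> d - K \<le> D (z - e * y)"
    and le: "(LINT y|std_normal_distribution. D (z - e * y)) \<le> \<eta>" and \<eta>: "0 \<le> \<eta>"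
  shows "d \<le> K + 4 / 3 * \<eta> + \<Delta> / 3"
proof (cases "d \<le> K")
  case True
  then show ?thesis using \<eta> \<Delta>[of 0] by simp
next
  case False
  interpret N: real_distribution std_normal_distribution by (rule real_dist_normal_dist)
  let ?B = "{y::real. 2 < \<bar>y\<bar>}"
  let ?p = "measure std_normal_distribution ?B"
  have [measurable]: "?B \<in> sets borel" by measurable
  have ind [simp]: "integrable std_normal_distribution (indicat_real ?B)"
    by (rule N.integrable_const_bound[of _ 1]) auto
  have "(d - K) * (1 - ?p) - \<Delta> * ?p = (LINT y|std_normal_distribution. (d - K) * (1 - indicator ?B y) - \<Delta> * indicator ?B y)"
    using N.prob_space ind by (simp del: ind)
  also have "\<dots> \<le> (LINT y|std_normal_distribution. D (z - e * y))"
  proof (rule integral_mono)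
    show "integrable std_normal_distribution (\<lambda>y. D (z - e * y))"
      by (rule N.integrable_const_bound[of _ \<Delta>]) (auto simp: \<Delta>)
    show "(d - K) * (1 - indicator ?B y) - \<Delta> * indicator ?B y \<le> D (z - e * y)" for y
      using K(2)[of y] \<Delta>[of "z - e * y"] by (auto simp: indicator_def)
  qed (auto intro!: integrable_diff integrable_mult_right)
  finally have 1: "(d - K) * (1 - ?p) - \<Delta> * ?p \<le> \<eta>" using le by simp
  have p: "0 \<le> ?p" "?p \<le> 1 / 4" using std_normal_tail_le[of 2] by auto
  \<comment> \<open>The tail event has probability at most \<open>1 / 4\<close>, so
    \<open>3 / 4 * (d - K) \<le> \<eta> + \<Delta> / 4\<close>; multiplying by \<open>4 / 3\<close>
    gives the claim.\<close>
  have "(d - K) * (3 / 4) \<le> (d - K) * (1 - ?p)" "\<Delta> * ?p \<le> \<Delta> * (1 / 4)"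
    using p False \<Delta>[of 0] by (auto intro!: mult_left_mono simp del: mult_le_cancel_left times_divide_eq_right mult_1_right)
  then show ?thesis using 1 by simp
qed

text \<open>A deviation of the cdfs at \<open>x\<close> persists, up to \<open>2 * e\<close>, at the
  neighbouring points over which smoothing averages. Hence
  \<open>\<Delta> \<le> 2 * e + 4 / 3 * \<eta> + \<Delta> / 3\<close>, and since
  \<open>\<Delta>\<close> is finite the last term can be absorbed, which multiplies the rest by
  \<open>3 / 2\<close>.\<close>

lemma gauss_smoothing:
  assumes "real_distribution W" and e: "0 < e"
    and \<eta>: "\<And>x. \<bar>cdf (gauss_smooth W e) x - cdf (gauss_smooth std_normal_distribution e) x\<bar> \<le> \<eta>"
  shows "\<bar>cdf W x - std_normal_cdf x\<bar> \<le> 2 * \<eta> + 3 * e"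
proof -
  interpret W: real_distribution W by fact
  interpret N: real_distribution std_normal_distribution by (rule real_dist_normal_dist)
  define D where "D x = cdf W x - std_normal_cdf x" for x
  define \<Delta> where "\<Delta> = (SUP x. \<bar>D x\<bar>)"
  have b01: "0 \<le> cdf W x" "cdf W x \<le> 1" "0 \<le> std_normal_cdf x" "std_normal_cdf x \<le> 1" for x
    by (auto simp: W.cdf_nonneg W.cdf_bounded_prob N.cdf_nonneg N.cdf_bounded_prob std_normal_cdf_def)
  have [measurable]: "cdf W \<in> borel_measurable borel" "std_normal_cdf \<in> borel_measurable borel"
    by (auto intro!: borel_measurable_mono simp: mono_def W.cdf_nondecreasing N.cdf_nondecreasing std_normal_cdf_def)
  have [measurable]: "D \<in> borel_measurable borel" unfolding D_def by measurable
  have bdd: "bdd_above (range (\<lambda>x. \<bar>D x\<bar>))"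
  proof (rule bdd_aboveI2[of _ _ 1])
    show "\<bar>D x\<bar> \<le> 1" for x using b01[of x] unfolding D_def by linarith
  qed
  have \<Delta>: "\<bar>D x\<bar> \<le> \<Delta>" for x unfolding \<Delta>_def by (rule cSUP_upper[OF _ bdd]) simp
  have "0 \<le> \<eta>" using \<eta>[of 0] by simp
  have ED: "(LINT y|std_normal_distribution. D (z - e * y)) = cdf (gauss_smooth W e) z - cdf (gauss_smooth std_normal_distribution e) z" for z
    unfolding D_def W.cdf_gauss_smooth N.cdf_gauss_smooth std_normal_cdf_def[symmetric]
    by (intro Bochner_Integration.integral_diff N.integrable_const_bound[of _ 1]) (use b01 in auto)
  \<comment> \<open>The point \<open>x + 2 * e - e * y\<close> lies between \<open>x\<close> and
    \<open>x + 4 * e\<close>: there \<open>cdf W\<close> is no smaller than at \<open>x\<close>,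
    while the normal cdf has grown by at most \<open>2 * e\<close>. The lower estimate mirrors this
    to the left.\<close>
  have up: "D x \<le> 2 * e + 4 / 3 * \<eta> + \<Delta> / 3" for x
  proof (rule gauss_smoothing_aux[where D = D and z = "x + 2 * e" and e = e])
    fix y :: real assume "\<bar>y\<bar> \<le> 2"
    then have *: "\<bar>e * y\<bar> \<le> e * 2" using e by (simp add: abs_mult)
    then have "cdf W x \<le> cdf W (x + 2 * e - e * y)" by (intro W.cdf_nondecreasing) auto
    moreover have "std_normal_cdf (x + 2 * e - e * y) - std_normal_cdf x \<le> (x + 2 * e - e * y - x) / 2"
      using * by (intro std_normal_cdf_diff_le) auto
    ultimately show "D x - 2 * e \<le> D (x + 2 * e - e * y)" using * by (auto simp: D_def field_simps)
  next
    show "(LINT y|std_normal_distribution. D (x + 2 * e - e * y)) \<le> \<eta>" unfolding ED using \<eta>[of "x + 2 * e"] by simp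
  qed (use e \<Delta> \<open>0 \<le> \<eta>\<close> in auto)
  have lo: "- D x \<le> 2 * e + 4 / 3 * \<eta> + \<Delta> / 3" for x
  proof (rule gauss_smoothing_aux[where D = "\<lambda>x. - D x" and z = "x - 2 * e" and e = e])
    fix y :: real assume "\<bar>y\<bar> \<le> 2"
    then have *: "\<bar>e * y\<bar> \<le> e * 2" using e by (simp add: abs_mult)
    then have "cdf W (x - 2 * e - e * y) \<le> cdf W x" by (intro W.cdf_nondecreasing) auto
    moreover have "std_normal_cdf x - std_normal_cdf (x - 2 * e - e * y) \<le> (x - (x - 2 * e - e * y)) / 2"
      using * by (intro std_normal_cdf_diff_le) auto
    ultimately show "- D x - 2 * e \<le> - D (x - 2 * e - e * y)" using * by (auto simp: D_def field_simps)
  next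
    show "(LINT y|std_normal_distribution. - D (x - 2 * e - e * y)) \<le> \<eta>" unfolding Bochner_Integration.integral_minus ED using \<eta>[of "x - 2 * e"] by simp
  qed (use e \<Delta> \<open>0 \<le> \<eta>\<close> in auto)
  have "\<Delta> \<le> 2 * e + 4 / 3 * \<eta> + \<Delta> / 3"
    unfolding \<Delta>_def by (rule cSUP_least) (use up lo in \<open>auto simp: abs_le_iff \<Delta>_def\<close>)
  then show ?thesis using \<Delta>[of x] by (simp add: D_def)
qed

section \<open>Characteristic functions of heavy-tailed symmetric laws\<close>

text \<open>Nonnegativity comes from \<open>cos y = 1 - 2 * (sin (y / 2))\<^sup>2\<close> and
  \<open>\<bar>sin z\<bar> \<le> \<bar>z\<bar>\<close>; the quartic bound is the real part of the
  third-order Taylor estimate for \<open>iexp y\<close>.\<close>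

lemma cos_minus_quadratic_bounds:
  fixes y :: real
  shows "0 \<le> cos y - 1 + y\<^sup>2 / 2" and "cos y - 1 + y\<^sup>2 / 2 \<le> y\<^sup>2 / 2"
    and "cos y - 1 + y\<^sup>2 / 2 \<le> y ^ 4"
proof -
  have "norm (iexp y - (\<Sum>k\<le>3. (\<i> * y)^k / fact k)) \<le> \<bar>y\<bar>^4 / fact 4"
    using iexp_approx1[of y 3] by simp
  moreover have "Re (iexp y - (\<Sum>k\<le>3. (\<i> * y)^k / fact k)) = cos y - 1 + y\<^sup>2 / 2"
    by (simp add: numeral_eq_Suc Re_exp power_mult_distrib complex_Re_of_int field_simps)
  ultimately have "\<bar>cos y - 1 + y\<^sup>2 / 2\<bar> \<le> \<bar>y\<bar>^4 / fact 4"
    using abs_Re_le_cmod[of "iexp y - (\<Sum>k\<le>3. (\<i> * y)^k / fact k)"] by simp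
  moreover have "\<bar>y\<bar>^4 / fact 4 \<le> y ^ 4" by (simp add: field_simps fact_numeral)
  ultimately show "cos y - 1 + y\<^sup>2 / 2 \<le> y ^ 4" by linarith
  show "cos y - 1 + y\<^sup>2 / 2 \<le> y\<^sup>2 / 2" by simp
  have "\<bar>sin (y / 2)\<bar> \<le> \<bar>y / 2\<bar>" by (rule abs_sin_x_le_abs_x)
  then have "(sin (y / 2))\<^sup>2 \<le> (y / 2)\<^sup>2" by (simp only: abs_le_square_iff)
  moreover have "cos y = 1 - 2 * (sin (y / 2))\<^sup>2" using cos_double_sin[of "y / 2"] by simp
  ultimately show "0 \<le> cos y - 1 + y\<^sup>2 / 2" by (simp add: power_divide)
qed

text \<open>Interpolates between the two upper bounds: the quartic one is used for
  \<open>\<bar>y\<bar> \<le> 1\<close>, the quadratic one beyond.\<close>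

lemma cos_minus_quadratic_le_powr:
  fixes y p :: real
  assumes "2 \<le> p" "p \<le> 4"
  shows "cos y - 1 + y\<^sup>2 / 2 \<le> \<bar>y\<bar> powr p"
proof (cases "\<bar>y\<bar> \<le> 1")
  case True
  have "y ^ 4 = \<bar>y\<bar> ^ 4" by simp
  also have "\<dots> \<le> \<bar>y\<bar> powr p"
    using True assms powr_mono'[of p 4 "\<bar>y\<bar>"] by (cases "y = 0") (auto simp: powr_numeral)
  finally show ?thesis using cos_minus_quadratic_bounds(3)[of y] by linarith
next
  case False
  have "y\<^sup>2 = \<bar>y\<bar> powr 2" using False by (subst powr_numeral) auto
  also have "\<dots> \<le> \<bar>y\<bar> powr p" using False assms by (intro powr_mono) auto
  finally show ?thesis using cos_minus_quadratic_bounds(2)[of y] zero_le_power2[of y] by linarith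
qed

text \<open>The product of \<open>1 - y + y\<^sup>2 / 2\<close> and
  \<open>1 + y + y\<^sup>2 / 2\<close> is \<open>1 + y ^ 4 / 4\<close>, hence at least
  \<open>1\<close>, and the second factor is at most \<open>exp y\<close>.\<close>

lemma exp_minus_upper:
  fixes y :: real
  assumes "0 \<le> y"
  shows "exp (- y) \<le> 1 - y + y\<^sup>2 / 2"
proof -
  have "1 + y + y\<^sup>2 / 2 \<le> exp y" by (rule exp_lower_Taylor_quadratic[OF assms])
  moreover have "1 \<le> (1 - y + y\<^sup>2 / 2) * (1 + y + y\<^sup>2 / 2)"
  proof -
    have "(1 - y + y\<^sup>2 / 2) * (1 + y + y\<^sup>2 / 2) = 1 + (y\<^sup>2)\<^sup>2 / 4"
      by (simp add: algebra_simps power2_eq_square)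
    then show ?thesis by simp
  qed
  moreover have "0 \<le> 1 - y + y\<^sup>2 / 2"
    using zero_le_power2[of "y - 1"] by (simp add: power2_eq_square algebra_simps)
  ultimately have "1 \<le> (1 - y + y\<^sup>2 / 2) * exp y" by (meson mult_left_mono order_trans)
  then show ?thesis by (simp add: exp_minus field_simps)
qed

text \<open>The uncentred second moment serves as the variance, since symmetry forces mean
  zero.\<close>

locale symmetric_distribution = real_distribution D for D :: "real measure" +
  fixes v :: real
  assumes symm: "distr D borel uminus = D"
    and square_integrable: "integrable D (\<lambda>x. x\<^sup>2)"
    and second_moment: "(LINT x|D. x\<^sup>2) = v"
    and v_pos: "0 < v"
begin

definition cf :: "real \<Rightarrow> real" where "cf s = (LINT x|D. cos (s * x))"

lemma integral_odd:
  fixes f :: "real \<Rightarrow> real"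
  assumes [measurable]: "f \<in> borel_measurable borel" and "\<And>x. f (- x) = - f x"
  shows "(LINT x|D. f x) = 0"
proof -
  have "(LINT x|D. f x) = (LINT x|distr D borel uminus. f x)" by (simp add: symm)
  also have "\<dots> = - (LINT x|D. f x)" by (subst integral_distr) (auto simp: assms(2))
  finally show ?thesis by simp
qed

lemma char_eq_cf: "char D s = of_real (cf s)"
proof -
  have i: "integrable D (\<lambda>x. iexp (s * x))" by (rule integrable_iexp) auto
  have "Re (char D s) = cf s" unfolding char_def cf_def
    using integral_Re[OF i] by (simp add: Re_exp)
  moreover have "Im (char D s) = 0" unfolding char_def
    using integral_Im[OF i] integral_odd[of "\<lambda>x. sin (s * x)"] by (simp add: Im_exp)
  ultimately show ?thesis by (simp add: complex_eq_iff)
qed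

lemma integrable_cos: "integrable D (\<lambda>x. cos (s * x))"
  by (rule integrable_const_bound[of _ 1]) auto

lemma cf_remainder:
  "cf s - 1 + v * s\<^sup>2 / 2 = (LINT x|D. cos (s * x) - 1 + (s * x)\<^sup>2 / 2)"
  "integrable D (\<lambda>x. cos (s * x) - 1 + (s * x)\<^sup>2 / 2)"
proof -
  show i: "integrable D (\<lambda>x. cos (s * x) - 1 + (s * x)\<^sup>2 / 2)"
    using integrable_cos square_integrable by (auto simp: power_mult_distrib)
  show "cf s - 1 + v * s\<^sup>2 / 2 = (LINT x|D. cos (s * x) - 1 + (s * x)\<^sup>2 / 2)"
    using integrable_cos[of s] square_integrable prob_space second_moment
    by (simp add: power_mult_distrib cf_def)
qed

text \<open>Where \<open>3 < \<bar>s * x\<bar>\<close> the integrand is at least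
  \<open>9 / 2 - 2\<close>, thus above \<open>1\<close>, and elsewhere it is nonnegative. This is
  how the tail of the law enters the characteristic function.\<close>

lemma cf_remainder_lower:
  assumes "s \<noteq> 0"
  shows "measure D {x. 3 / \<bar>s\<bar> < \<bar>x\<bar>} \<le> cf s - 1 + v * s\<^sup>2 / 2"
proof -
  have "measure D {x. 3 / \<bar>s\<bar> < \<bar>x\<bar>} = (LINT x|D. indicator {x. 3 / \<bar>s\<bar> < \<bar>x\<bar>} x)" by simp
  also have "\<dots> \<le> cf s - 1 + v * s\<^sup>2 / 2" unfolding cf_remainder(1)
  proof (rule integral_mono[OF _ cf_remainder(2)])
    show "integrable D (indicat_real {x. 3 / \<bar>s\<bar> < \<bar>x\<bar>})"
      by (rule integrable_const_bound[of _ 1]) auto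
    fix x
    show "indicat_real {x. 3 / \<bar>s\<bar> < \<bar>x\<bar>} x \<le> cos (s * x) - 1 + (s * x)\<^sup>2 / 2"
    proof (cases "3 / \<bar>s\<bar> < \<bar>x\<bar>")
      case True
      then have "3 \<le> \<bar>s * x\<bar>" using assms by (simp add: field_simps abs_mult)
      then have "3\<^sup>2 \<le> (s * x)\<^sup>2" using abs_le_square_iff[of 3 "s * x"] by simp
      then show ?thesis using True cos_ge_minus_one[of "s * x"] by (simp del: cos_ge_minus_one)
    qed (use cos_minus_quadratic_bounds(1)[of "s * x"] in auto)
  qed
  finally show ?thesis .
qed

lemma cf_remainder_upper:
  assumes "2 \<le> p" "p \<le> 4" "integrable D (\<lambda>x. \<bar>x\<bar> powr p)"
  shows "cf s - 1 + v * s\<^sup>2 / 2 \<le> (LINT x|D. \<bar>x\<bar> powr p) * \<bar>s\<bar> powr p"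
proof -
  have "cf s - 1 + v * s\<^sup>2 / 2 \<le> (LINT x|D. \<bar>s\<bar> powr p * \<bar>x\<bar> powr p)" unfolding cf_remainder(1)
    using assms cos_minus_quadratic_le_powr[OF assms(1,2), of "s * _"]
    by (intro integral_mono[OF cf_remainder(2)]) (auto simp: abs_mult powr_mult)
  then show ?thesis by (simp add: mult.commute)
qed

end

section \<open>Powers of the characteristic function against the Gaussian\<close>

text \<open>In the factorisation of \<open>a ^ n - b ^ n\<close> by \<open>a - b\<close>, each of
  the \<open>n\<close> summands lies between \<open>b ^ (n - 1)\<close> and
  \<open>a ^ (n - 1)\<close>. For \<open>n = 0\<close> everything is \<open>0\<close>.\<close>

lemma power_diff_bounds:
  fixes a b :: real
  assumes "0 \<le> b" "b \<le> a"
  shows "real n * b ^ (n - 1) * (a - b) \<le> a ^ n - b ^ n"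
    and "a ^ n - b ^ n \<le> real n * a ^ (n - 1) * (a - b)"
proof -
  have eq: "a ^ n - b ^ n = (a - b) * (\<Sum>i<n. b ^ (n - Suc i) * a ^ i)"
    by (rule power_diff_sumr2)
  have split: "c ^ (n - Suc 0) = c ^ (n - Suc i) * c ^ i" if "i < n" for i and c :: real
    using that by (simp add: power_add[symmetric])
  have "(\<Sum>i<n. b ^ (n - 1)) \<le> (\<Sum>i<n. b ^ (n - Suc i) * a ^ i)"
    by (intro sum_mono) (use assms in \<open>auto simp: split intro!: mult_left_mono power_mono\<close>)
  then have "(a - b) * (real n * b ^ (n - 1)) \<le> a ^ n - b ^ n"
    unfolding eq using assms by (intro mult_left_mono) auto
  then show "real n * b ^ (n - 1) * (a - b) \<le> a ^ n - b ^ n" by (simp add: mult_ac)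
  have "(\<Sum>i<n. b ^ (n - Suc i) * a ^ i) \<le> (\<Sum>i<n. a ^ (n - 1))"
    by (intro sum_mono) (use assms in \<open>auto simp: split intro!: mult_right_mono power_mono\<close>)
  then have "a ^ n - b ^ n \<le> (a - b) * (real n * a ^ (n - 1))"
    unfolding eq using assms by (intro mult_left_mono) auto
  then show "a ^ n - b ^ n \<le> real n * a ^ (n - 1) * (a - b)" by (simp add: mult_ac)
qed

text \<open>The tail is described by two-sided bounds of order \<open>x powr (- \<alpha>)\<close>
  only, so that the locale covers both an exact tail asymptotic and the Student density.\<close>

locale heavy_tailed_distribution = symmetric_distribution +
  fixes \<alpha> :: real
  assumes alpha: "2 < \<alpha>" "\<alpha> < 3"
    and tail_lower: "\<exists>c>0. \<exists>x0>0. \<forall>x\<ge>x0. c * x powr (- \<alpha>) \<le> measure D {y. x < \<bar>y\<bar>}"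
    and tail_upper: "\<exists>C. \<exists>x0>0. \<forall>x\<ge>x0. measure D {y. x < \<bar>y\<bar>} \<le> C * x powr (- \<alpha>)"
begin

text \<open>The remainder is at least \<open>k * \<bar>s\<bar> powr \<alpha>\<close>, while
  replacing \<open>1 - v * s\<^sup>2 / 2\<close> by the exponential costs only a multiple of
  \<open>s ^ 4\<close>. Near \<open>0\<close> this uses up at most half of the gain.\<close>

lemma cf_near_zero_lower:
  obtains s0 c where "0 < s0" "0 < c"
    "\<And>s. \<bar>s\<bar> \<le> s0 \<Longrightarrow> exp (- (v * s\<^sup>2 / 2)) + c * \<bar>s\<bar> powr \<alpha> \<le> cf s"
proof -
  obtain c x0 where c: "0 < c" "0 < x0" "\<And>x. x0 \<le> x \<Longrightarrow> c * x powr (- \<alpha>) \<le> measure D {y. x < \<bar>y\<bar>}"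
    using tail_lower by blast
  define k where "k = c * 3 powr (- \<alpha>)"
  have k: "0 < k" using c by (simp add: k_def)
  \<comment> \<open>The bound \<open>3 / x0\<close> brings \<open>3 / \<bar>s\<bar>\<close> into the
    range of the tail estimate; \<open>1\<close> gives
    \<open>\<bar>s\<bar> powr (4 - \<alpha>) \<le> \<bar>s\<bar>\<close>, and
    \<open>4 * k / v\<^sup>2\<close> then makes the quartic error at most half of the main
    term.\<close>
  define s0 where "s0 = Min {1, 3 / x0, 4 * k / v\<^sup>2}"
  have s0: "0 < s0" "s0 \<le> 1" "s0 \<le> 3 / x0" "s0 \<le> 4 * k / v\<^sup>2"
    using c k v_pos by (auto simp: s0_def)
  show thesis
  proof
    show "0 < s0" "0 < k / 2" using s0 k by auto
    fix s :: real assume s: "\<bar>s\<bar> \<le> s0"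
    show "exp (- (v * s\<^sup>2 / 2)) + k / 2 * \<bar>s\<bar> powr \<alpha> \<le> cf s"
    proof (cases "s = 0")
      case True
      then show ?thesis using prob_space by (simp add: cf_def)
    next
      case False
      have "\<bar>s\<bar> \<le> 3 / x0" using s s0 by linarith
      then have "x0 \<le> 3 / \<bar>s\<bar>" using c False by (simp add: field_simps)
      then have "c * (3 / \<bar>s\<bar>) powr (- \<alpha>) \<le> cf s - 1 + v * s\<^sup>2 / 2"
        using c(3) cf_remainder_lower[OF False] by (meson order_trans)
      moreover have "c * (3 / \<bar>s\<bar>) powr (- \<alpha>) = k * \<bar>s\<bar> powr \<alpha>"
        using False by (simp add: k_def powr_divide powr_minus field_simps)
      moreover have "exp (- (v * s\<^sup>2 / 2)) \<le> 1 - v * s\<^sup>2 / 2 + (v * s\<^sup>2 / 2)\<^sup>2 / 2"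
        using v_pos by (intro exp_minus_upper) auto
      moreover have "(v * s\<^sup>2 / 2)\<^sup>2 / 2 \<le> k / 2 * \<bar>s\<bar> powr \<alpha>"
      proof -
        have "s ^ 4 = \<bar>s\<bar> powr 4" using False by (subst powr_numeral) auto
        also have "\<dots> = \<bar>s\<bar> powr \<alpha> * \<bar>s\<bar> powr (4 - \<alpha>)" by (simp add: powr_add[symmetric])
        also have "\<bar>s\<bar> powr (4 - \<alpha>) \<le> \<bar>s\<bar> powr 1"
          using s s0 alpha False by (intro powr_mono') auto
        also have "\<dots> \<le> 4 * k / v\<^sup>2" using s s0 by simp
        finally have "v\<^sup>2 / 8 * s ^ 4 \<le> v\<^sup>2 / 8 * (\<bar>s\<bar> powr \<alpha> * (4 * k / v\<^sup>2))"
          by (intro mult_left_mono) (auto simp: mult_left_mono)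
        also have "\<dots> = k / 2 * \<bar>s\<bar> powr \<alpha>" using v_pos by simp
        also have "v\<^sup>2 / 8 * s ^ 4 = (v * s\<^sup>2 / 2)\<^sup>2 / 2"
          by (simp add: power2_eq_square power4_eq_xxxx)
        finally show ?thesis .
      qed
      ultimately show ?thesis by linarith
    qed
  qed
qed

text \<open>Both estimates combine the remainder bound with \<open>1 - y \<le> exp (- y)\<close>. In
  the second, for small \<open>s\<close>, the remainder takes up half of the quadratic term, whence
  the exponent \<open>1 / 4\<close>.\<close>

lemma cf_near_zero_upper:
  assumes p: "2 < p" "p \<le> 4" "integrable D (\<lambda>x. \<bar>x\<bar> powr p)"
  obtains s0 where "0 < s0"
    "\<And>s. cf s \<le> exp (- (v * s\<^sup>2 / 2)) + (LINT x|D. \<bar>x\<bar> powr p) * \<bar>s\<bar> powr p"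
    "\<And>s. \<bar>s\<bar> \<le> s0 \<Longrightarrow> cf s \<le> exp (- (v * s\<^sup>2 / 4))"
proof -
  define m where "m = (LINT x|D. \<bar>x\<bar> powr p)"
  have m: "0 \<le> m" by (simp add: m_def)
  have up: "cf s - 1 + v * s\<^sup>2 / 2 \<le> m * \<bar>s\<bar> powr p" for s
    unfolding m_def using p by (intro cf_remainder_upper) auto
  \<comment> \<open>Chosen so that \<open>(m + 1) * s0 powr (p - 2) = v / 4\<close>;
    \<open>m + 1\<close> keeps the denominator positive when only \<open>0 \<le> m\<close> is
    known.\<close>
  define s0 where "s0 = (v / (4 * (m + 1))) powr (1 / (p - 2))"
  show thesis
  proof
    show "0 < s0" using v_pos m by (auto simp: s0_def)
    show "cf s \<le> exp (- (v * s\<^sup>2 / 2)) + (LINT x|D. \<bar>x\<bar> powr p) * \<bar>s\<bar> powr p" for s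
      using up[of s] exp_ge_add_one_self[of "- (v * s\<^sup>2 / 2)"] unfolding m_def by linarith
    fix s assume s: "\<bar>s\<bar> \<le> s0"
    have "\<bar>s\<bar> powr (p - 2) \<le> s0 powr (p - 2)" using s p by (intro powr_mono2) auto
    also have "\<dots> = v / (4 * (m + 1))" using p v_pos m by (simp add: s0_def powr_powr)
    finally have "(m + 1) * \<bar>s\<bar> powr (p - 2) \<le> v / 4" using m by (simp add: field_simps)
    moreover have "m * \<bar>s\<bar> powr (p - 2) \<le> (m + 1) * \<bar>s\<bar> powr (p - 2)" by (intro mult_right_mono) auto
    ultimately have *: "m * \<bar>s\<bar> powr (p - 2) \<le> v / 4" by linarith
    have "m * \<bar>s\<bar> powr p = (m * \<bar>s\<bar> powr (p - 2)) * s\<^sup>2"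
    proof (cases "s = 0")
      case False
      have "\<bar>s\<bar> powr p = \<bar>s\<bar> powr (p - 2) * \<bar>s\<bar> powr 2" unfolding powr_add[symmetric] by simp
      also have "\<bar>s\<bar> powr 2 = s\<^sup>2" using False by (subst powr_numeral) auto
      finally show ?thesis by simp
    qed simp
    also have "\<dots> \<le> v / 4 * s\<^sup>2" by (intro mult_right_mono *) auto
    finally show "cf s \<le> exp (- (v * s\<^sup>2 / 4))"
      using up[of s] exp_ge_add_one_self[of "- (v * s\<^sup>2 / 4)"] by (simp add: field_simps)
  qed
qed

text \<open>The characteristic function of the standardized sum of \<open>n\<close> independent
  copies, written as a real function.\<close>

definition sum_cf :: "nat \<Rightarrow> real \<Rightarrow> real" where
  "sum_cf n t = cf (t / sqrt (v * real n)) ^ n"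

lemma cf_le_1: "\<bar>cf s\<bar> \<le> 1"
  using cmod_char_le_1[of s] by (simp add: char_eq_cf)

lemma sum_cf_le_1: "\<bar>sum_cf n t\<bar> \<le> 1"
  by (simp add: sum_cf_def power_abs power_le_one cf_le_1)

lemma sum_cf_diff_le_2: "\<bar>sum_cf n t - exp (- t\<^sup>2 / 2)\<bar> \<le> 2"
proof -
  have "exp (- t\<^sup>2 / 2) \<le> 1" "0 \<le> exp (- t\<^sup>2 / 2)" by simp_all
  then show ?thesis using sum_cf_le_1[of n t] by linarith
qed

text \<open>A mean value estimate for the \<open>n\<close>-th power: the gain
  \<open>c * \<bar>s\<bar> powr \<alpha>\<close> of one factor is multiplied by \<open>n\<close>,
  and \<open>n * (1 / sqrt n) powr \<alpha>\<close> is the claimed rate.\<close>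

lemma sum_cf_lower:
  obtains r c where "0 < r" "0 < c"
    "\<And>n t. 1 \<le> n \<Longrightarrow> \<bar>t\<bar> \<le> r * sqrt (real n) \<Longrightarrow>
       c * real n powr (- (\<alpha> - 2) / 2) * (\<bar>t\<bar> powr \<alpha> * exp (- t\<^sup>2 / 2)) \<le> sum_cf n t - exp (- t\<^sup>2 / 2)"
proof -
  obtain s0 c where s0: "0 < s0" and c: "0 < c"
    and low: "\<And>s. \<bar>s\<bar> \<le> s0 \<Longrightarrow> exp (- (v * s\<^sup>2 / 2)) + c * \<bar>s\<bar> powr \<alpha> \<le> cf s"
    using cf_near_zero_lower by metis
  show thesis
  proof
    show "0 < s0 * sqrt v" "0 < c * v powr (- \<alpha> / 2)" using s0 c v_pos by auto
    fix n :: nat and t :: real assume n: "1 \<le> n" and t: "\<bar>t\<bar> \<le> s0 * sqrt v * sqrt (real n)"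
    define s where "s = t / sqrt (v * real n)"
    have vs: "v * s\<^sup>2 * real n = t\<^sup>2" using n v_pos by (simp add: s_def power_divide)
    have s: "\<bar>s\<bar> \<le> s0" using t n v_pos by (simp add: s_def field_simps real_sqrt_mult abs_mult)
    define b where "b = exp (- (v * s\<^sup>2 / 2))"
    have b: "0 \<le> b" "b \<le> 1" using v_pos by (auto simp: b_def)
    have bn: "b ^ n = exp (- t\<^sup>2 / 2)" unfolding b_def exp_of_nat_mult[symmetric] vs[symmetric] by (simp add: mult_ac)
    have cb: "c * \<bar>s\<bar> powr \<alpha> \<le> cf s - b" using low[OF s] by (simp add: b_def)
    then have "b \<le> cf s" using c by (smt (verit) mult_nonneg_nonneg powr_ge_zero)
    have "c * v powr (- \<alpha> / 2) * real n powr (- (\<alpha> - 2) / 2) * (\<bar>t\<bar> powr \<alpha> * exp (- t\<^sup>2 / 2))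
        = real n * b ^ n * (c * \<bar>s\<bar> powr \<alpha>)"
    proof -
      have "\<bar>s\<bar> powr \<alpha> = \<bar>t\<bar> powr \<alpha> * (v powr (- \<alpha> / 2) * real n powr (- \<alpha> / 2))"
        using v_pos n by (simp add: s_def abs_divide powr_divide abs_mult powr_half_sqrt[symmetric] powr_powr powr_mult powr_minus divide_simps del: powr_half_sqrt)
      moreover have "real n powr (- (\<alpha> - 2) / 2) = real n powr 1 * real n powr (- \<alpha> / 2)"
        unfolding powr_add[symmetric] by (rule arg_cong[where f = "\<lambda>x. real n powr x"]) (simp add: field_simps)
      ultimately show ?thesis using n by (simp add: bn)
    qed
    \<comment> \<open>Since \<open>b \<le> 1\<close>, passing from \<open>b ^ n\<close> to
      \<open>b ^ (n - 1)\<close> only increases the value, and \<open>b ^ n\<close> is exactly the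
      Gaussian.\<close>
    also have "\<dots> \<le> real n * b ^ (n - 1) * (cf s - b)"
      using b c by (intro mult_mono cb mult_left_mono power_decreasing) auto
    also have "\<dots> \<le> cf s ^ n - b ^ n" by (rule power_diff_bounds) fact+
    finally show "c * v powr (- \<alpha> / 2) * real n powr (- (\<alpha> - 2) / 2) * (\<bar>t\<bar> powr \<alpha> * exp (- t\<^sup>2 / 2))
      \<le> sum_cf n t - exp (- t\<^sup>2 / 2)" by (simp add: bn sum_cf_def s_def)
  qed
qed

text \<open>The \<open>n\<close>-th powers are compared through the larger base \<open>cf s\<close>,
  for which only the decay rate \<open>1 / 4\<close> is available. The lower estimate near
  \<open>0\<close> gives \<open>b \<le> cf s\<close>, so the difference is nonnegative and its
  absolute value needs only one side.\<close>

lemma sum_cf_upper: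
  assumes p: "2 < p" "p \<le> 4" "integrable D (\<lambda>x. \<bar>x\<bar> powr p)"
  obtains r C where "0 < r" "0 \<le> C"
    "\<And>n t. 1 \<le> n \<Longrightarrow> \<bar>t\<bar> \<le> r * sqrt (real n) \<Longrightarrow>
       \<bar>sum_cf n t - exp (- t\<^sup>2 / 2)\<bar> \<le> C * real n powr (- (p - 2) / 2) * (\<bar>t\<bar> powr p * exp (- t\<^sup>2 / 4))"
proof -
  obtain s1 c where s1: "0 < s1" and c: "0 < c"
    and low: "\<And>s. \<bar>s\<bar> \<le> s1 \<Longrightarrow> exp (- (v * s\<^sup>2 / 2)) + c * \<bar>s\<bar> powr \<alpha> \<le> cf s"
    using cf_near_zero_lower by metis
  define m where "m = (LINT x|D. \<bar>x\<bar> powr p)"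
  have m: "0 \<le> m" by (simp add: m_def)
  obtain s2 where s2: "0 < s2"
    and up: "\<And>s. cf s \<le> exp (- (v * s\<^sup>2 / 2)) + m * \<bar>s\<bar> powr p"
    and up2: "\<And>s. \<bar>s\<bar> \<le> s2 \<Longrightarrow> cf s \<le> exp (- (v * s\<^sup>2 / 4))"
    using cf_near_zero_upper[OF p] unfolding m_def by metis
  define s0 where "s0 = min s1 s2"
  define C where "C = m * exp (v * s0\<^sup>2 / 4)"
  have s0: "0 < s0" "s0 \<le> s1" "s0 \<le> s2" using s1 s2 by (auto simp: s0_def)
  have C: "0 \<le> C" using m by (simp add: C_def)
  show thesis
  proof
    show "0 < s0 * sqrt v" "0 \<le> C * v powr (- p / 2)" using s0 C v_pos by auto
    fix n :: nat and t :: real assume n: "1 \<le> n" and t: "\<bar>t\<bar> \<le> s0 * sqrt v * sqrt (real n)"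
    define s where "s = t / sqrt (v * real n)"
    have vs: "v * s\<^sup>2 * real n = t\<^sup>2" using n v_pos by (simp add: s_def power_divide)
    have s: "\<bar>s\<bar> \<le> s0" using t n v_pos by (simp add: s_def field_simps real_sqrt_mult abs_mult)
    define b where "b = exp (- (v * s\<^sup>2 / 2))"
    have b: "0 \<le> b" "b \<le> 1" using v_pos by (auto simp: b_def)
    have bn: "b ^ n = exp (- t\<^sup>2 / 2)" unfolding b_def exp_of_nat_mult[symmetric] vs[symmetric] by (simp add: mult_ac)
    have "c * \<bar>s\<bar> powr \<alpha> \<le> cf s - b" using low[of s] s s0 by (simp add: b_def)
    then have bc: "b \<le> cf s" using c by (smt (verit) mult_nonneg_nonneg powr_ge_zero)
    have cfb: "cf s - b \<le> m * \<bar>s\<bar> powr p" using up[of s] by (simp add: b_def)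
    \<comment> \<open>With \<open>n - 1\<close> factors instead of \<open>n\<close> the Gaussian is
      missed by \<open>exp (v * s\<^sup>2 / 4)\<close>, which is bounded for
      \<open>\<bar>s\<bar> \<le> s0\<close> and is part of \<open>C\<close>.\<close>
    have "cf s ^ (n - 1) \<le> exp (- (v * s\<^sup>2 / 4)) ^ (n - 1)"
      using up2[of s] s s0 bc b by (intro power_mono) auto
    also have "\<dots> = exp (- t\<^sup>2 / 4) * exp (v * s\<^sup>2 / 4)"
      unfolding exp_of_nat_mult[symmetric] exp_add[symmetric] vs[symmetric] using n
      by (simp add: of_nat_diff field_simps)
    also have "\<dots> \<le> exp (- t\<^sup>2 / 4) * exp (v * s0\<^sup>2 / 4)"
      using s v_pos abs_le_square_iff[of s s0] s0 by (intro mult_left_mono) auto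
    finally have pw: "cf s ^ (n - 1) \<le> exp (- t\<^sup>2 / 4) * exp (v * s0\<^sup>2 / 4)" .
    have "cf s ^ n - b ^ n \<le> real n * cf s ^ (n - 1) * (cf s - b)" using b bc by (intro power_diff_bounds) auto
    also have "\<dots> \<le> real n * (exp (- t\<^sup>2 / 4) * exp (v * s0\<^sup>2 / 4)) * (m * \<bar>s\<bar> powr p)"
      using b bc by (intro mult_mono cfb mult_left_mono pw) auto
    also have "\<dots> = C * v powr (- p / 2) * real n powr (- (p - 2) / 2) * (\<bar>t\<bar> powr p * exp (- t\<^sup>2 / 4))"
    proof -
      have "\<bar>s\<bar> powr p = \<bar>t\<bar> powr p * (v powr (- p / 2) * real n powr (- p / 2))"
        using v_pos n by (simp add: s_def abs_divide powr_divide abs_mult powr_half_sqrt[symmetric] powr_powr powr_mult powr_minus divide_simps del: powr_half_sqrt)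
      moreover have "real n powr (- (p - 2) / 2) = real n powr 1 * real n powr (- p / 2)"
        unfolding powr_add[symmetric] by (rule arg_cong[where f = "\<lambda>x. real n powr x"]) (simp add: field_simps)
      ultimately show ?thesis using n by (simp add: C_def)
    qed
    finally show "\<bar>sum_cf n t - exp (- t\<^sup>2 / 2)\<bar> \<le> C * v powr (- p / 2) * real n powr (- (p - 2) / 2) * (\<bar>t\<bar> powr p * exp (- t\<^sup>2 / 4))"
      using power_mono[OF bc b(1), of n] by (simp add: bn sum_cf_def s_def)
  qed
qed

end

section \<open>Upper bound\<close>

lemma integral_exp_neg_square:
  assumes "0 < c"
  shows "integrable lborel (\<lambda>t::real. exp (- c * t\<^sup>2))"
    and "(LINT t|lborel. exp (- c * t\<^sup>2)) = sqrt (pi / c)"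
proof -
  have e: "exp (- c * t\<^sup>2) = sqrt (pi / c) * normal_density 0 (1 / sqrt (2 * c)) t" for t :: real
    using assms by (simp add: normal_density_def power_divide real_sqrt_divide)
  show "integrable lborel (\<lambda>t::real. exp (- c * t\<^sup>2))" "(LINT t|lborel. exp (- c * t\<^sup>2)) = sqrt (pi / c)"
    unfolding e using assms by auto
qed

text \<open>The power is at most \<open>1 + t\<^sup>2\<close>, which half of the Gaussian decay
  absorbs: with \<open>u = t\<^sup>2 / 8\<close> one has
  \<open>1 + 8 * u \<le> 9 * exp u\<close>.\<close>

lemma powr_exp_neg_bound:
  fixes t p :: real
  assumes "1 \<le> p" "p \<le> 3"
  shows "\<bar>t\<bar> powr (p - 1) * exp (- t\<^sup>2 / 4) \<le> 9 * exp (- (1 / 8) * t\<^sup>2)"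
proof -
  have "\<bar>t\<bar> powr (p - 1) \<le> 1 + t\<^sup>2"
  proof (cases "\<bar>t\<bar> \<le> 1")
    case True
    then have "\<bar>t\<bar> powr (p - 1) \<le> 1" using assms powr_le1[of "p - 1" "\<bar>t\<bar>"] by simp
    then show ?thesis using zero_le_power2[of t] by linarith
  next
    case False
    then have "\<bar>t\<bar> powr (p - 1) \<le> \<bar>t\<bar> powr 2" using assms by (intro powr_mono) auto
    also have "\<dots> = t\<^sup>2" using False by (subst powr_numeral) auto
    finally show ?thesis by simp
  qed
  also have "1 + t\<^sup>2 \<le> 9 * exp (t\<^sup>2 / 8)"
    using exp_ge_add_one_self[of "t\<^sup>2 / 8"] exp_ge_zero[of "t\<^sup>2 / 8"] by argo
  finally have "\<bar>t\<bar> powr (p - 1) * exp (- t\<^sup>2 / 4) \<le> 9 * exp (t\<^sup>2 / 8) * exp (- t\<^sup>2 / 4)"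
    by (intro mult_right_mono) auto
  also have "\<dots> = 9 * exp (- (1 / 8) * t\<^sup>2)" by (simp add: exp_add[symmetric])
  finally show ?thesis .
qed

context heavy_tailed_distribution begin

text \<open>Up to frequency \<open>T\<close> the local estimate contributes order \<open>e\<close>.
  Beyond \<open>T\<close> only the trivial bound \<open>2\<close> is available, and the smoothing
  factor supplies the decay.\<close>

lemma kolmogorov_upper_bound:
  assumes \<delta>: "0 < \<delta>" "\<delta> < 1" and mom: "integrable D (\<lambda>x. \<bar>x\<bar> powr (2 + \<delta>))"
  obtains C where "\<And>n W x. 1 \<le> n \<Longrightarrow> real_distribution W \<Longrightarrow> char W = (\<lambda>t. of_real (sum_cf n t)) \<Longrightarrow>
     \<bar>cdf W x - std_normal_cdf x\<bar> \<le> C * real n powr (- \<delta> / 2)"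
proof -
  obtain r C where r: "0 < r" and C: "0 \<le> C"
    and near: "\<And>n t. 1 \<le> n \<Longrightarrow> \<bar>t\<bar> \<le> r * sqrt (real n) \<Longrightarrow>
       \<bar>sum_cf n t - exp (- t\<^sup>2 / 2)\<bar> \<le> C * real n powr (- ((2 + \<delta>) - 2) / 2) * (\<bar>t\<bar> powr (2 + \<delta>) * exp (- t\<^sup>2 / 4))"
    by (rule sum_cf_upper[OF _ _ mom]) (use \<delta> in auto)
  \<comment> \<open>Because \<open>\<delta> < 1\<close> the exponential beats the power; convergence
    then yields one constant \<open>K\<close> valid for every \<open>n\<close>.\<close>
  have "(\<lambda>n. real n powr (\<delta> / 2) * exp (- (r\<^sup>2 / 4) * real n powr (1 - \<delta>))) \<longlonglongrightarrow> 0"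
    using r \<delta> by real_asymp
  then have "Bseq (\<lambda>n. real n powr (\<delta> / 2) * exp (- (r\<^sup>2 / 4) * real n powr (1 - \<delta>)))"
    by (intro convergent_imp_Bseq) (auto simp: convergent_def)
  then obtain K where K: "0 < K" "\<And>n. real n powr (\<delta> / 2) * exp (- (r\<^sup>2 / 4) * real n powr (1 - \<delta>)) \<le> K"
    unfolding Bseq_def by auto
  define A where "A = (1 / pi) * (9 * C * sqrt (pi / (1 / 8)) + 2 / r * K * sqrt (4 * pi))"
  show thesis
  proof (rule that)
    fix n :: nat and W :: "real measure" and x :: real
    assume n: "1 \<le> n" and W: "real_distribution W" and ch: "char W = (\<lambda>t. of_real (sum_cf n t))"
    interpret W: real_distribution W by fact
    interpret N: real_distribution std_normal_distribution by (rule real_dist_normal_dist)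
    define e where "e = real n powr (- \<delta> / 2)"
    define T where "T = r * sqrt (real n)"
    have e: "0 < e" "e \<le> 1" using n \<delta> by (auto simp: e_def powr_minus ge_one_powr_ge_zero inverse_le_1_iff)
    have T: "0 < T" using r n by (simp add: T_def)
    define B where "B = 2 / T * exp (- (e * T)\<^sup>2 / 4)"
    have B: "0 \<le> B" using T by (simp add: B_def)
    define g where "g t = 9 * C * e * exp (- (1 / 8) * t\<^sup>2) + B * exp (- (e\<^sup>2 / 4) * t\<^sup>2)" for t :: real
    have gint: "integrable lborel g"
      unfolding g_def using e by (intro Bochner_Integration.integrable_add integrable_mult_right integral_exp_neg_square) auto
    have g0: "0 \<le> g t" for t using B C e by (simp add: g_def)
    have le: "cmod (char (gauss_smooth W e) t - char (gauss_smooth std_normal_distribution e) t) \<le> \<bar>t\<bar> * g t" for t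
    proof -
      have "char (gauss_smooth W e) t - char (gauss_smooth std_normal_distribution e) t
        = of_real ((sum_cf n t - exp (- t\<^sup>2 / 2)) * exp (- (e * t)\<^sup>2 / 2))"
        by (simp add: W.char_gauss_smooth N.char_gauss_smooth ch char_std_normal_distribution algebra_simps)
      then have eq: "cmod (char (gauss_smooth W e) t - char (gauss_smooth std_normal_distribution e) t)
        = \<bar>sum_cf n t - exp (- t\<^sup>2 / 2)\<bar> * exp (- (e * t)\<^sup>2 / 2)"
        by (simp only: norm_of_real abs_mult abs_exp_cancel)
      show ?thesis
      proof (cases "\<bar>t\<bar> \<le> T")
        case True
        have "\<bar>sum_cf n t - exp (- t\<^sup>2 / 2)\<bar> * exp (- (e * t)\<^sup>2 / 2) \<le> \<bar>sum_cf n t - exp (- t\<^sup>2 / 2)\<bar> * 1"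
          by (intro mult_left_mono) auto
        also have "\<dots> \<le> C * e * (\<bar>t\<bar> powr (2 + \<delta>) * exp (- t\<^sup>2 / 4))"
          using near[OF n True[unfolded T_def]] by (simp add: e_def)
        also have "\<dots> = C * e * (\<bar>t\<bar> * (\<bar>t\<bar> powr (2 + \<delta> - 1) * exp (- t\<^sup>2 / 4)))"
        proof (cases "t = 0")
          case False
          have "\<bar>t\<bar> powr (2 + \<delta>) = \<bar>t\<bar> powr 1 * \<bar>t\<bar> powr (2 + \<delta> - 1)" unfolding powr_add[symmetric] by simp
          then show ?thesis by simp
        qed simp
        also have "\<dots> \<le> C * e * (\<bar>t\<bar> * (9 * exp (- (1 / 8) * t\<^sup>2)))"
          using C e \<delta> by (intro mult_left_mono powr_exp_neg_bound) auto
        also have "\<dots> \<le> \<bar>t\<bar> * g t" using B by (simp add: g_def algebra_simps)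
        finally show ?thesis unfolding eq .
      next
        case False
        have "\<bar>sum_cf n t - exp (- t\<^sup>2 / 2)\<bar> \<le> 2"
by (rule sum_cf_diff_le_2)
        then have "\<bar>sum_cf n t - exp (- t\<^sup>2 / 2)\<bar> * exp (- (e * t)\<^sup>2 / 2) \<le> 2 * exp (- (e * t)\<^sup>2 / 2)"
          by (intro mult_right_mono) auto
        \<comment> \<open>One half of the smoothing exponent is frozen at \<open>T\<close> to give
          smallness, the other half stays for integrability in \<open>t\<close>. The divisor
          \<open>T\<close> in \<open>B\<close> is compensated by
          \<open>T < \<bar>t\<bar>\<close>.\<close>
        also have "\<dots> = 2 * (exp (- (e * t)\<^sup>2 / 4) * exp (- (e\<^sup>2 / 4) * t\<^sup>2))"
          by (simp add: exp_add[symmetric] power_mult_distrib)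
        also have "\<dots> \<le> 2 * (exp (- (e * T)\<^sup>2 / 4) * exp (- (e\<^sup>2 / 4) * t\<^sup>2))"
        proof -
          have "(e * T)\<^sup>2 \<le> (e * t)\<^sup>2"
            using False T e by (intro abs_le_square_iff[THEN iffD1]) (auto simp: abs_mult)
          then show ?thesis by (intro mult_left_mono mult_right_mono) auto
        qed
        also have "\<dots> = T * (B * exp (- (e\<^sup>2 / 4) * t\<^sup>2))" using T by (simp add: B_def)
        also have "\<dots> \<le> \<bar>t\<bar> * (B * exp (- (e\<^sup>2 / 4) * t\<^sup>2))" using False B by (intro mult_right_mono) auto
        also have "\<dots> \<le> \<bar>t\<bar> * g t" using C e by (simp add: g_def mult_left_mono)
        finally show ?thesis unfolding eq .
      qed
    qed
    have k1: "\<bar>cdf (gauss_smooth W e) y - cdf (gauss_smooth std_normal_distribution e) y\<bar> \<le> (1 / pi) * (LINT t|lborel. g t)" for y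
      using e by (intro cdf_diff_le_char W.real_distribution_gauss_smooth N.real_distribution_gauss_smooth
        W.measure_gauss_smooth_singleton N.measure_gauss_smooth_singleton gint g0 le) auto
    have k2: "(LINT t|lborel. g t) = 9 * C * e * sqrt (pi / (1 / 8)) + B * sqrt (pi / (e\<^sup>2 / 4))"
    proof -
      note i1 = integral_exp_neg_square[of "1 / 8"] and i2 = integral_exp_neg_square[of "e\<^sup>2 / 4"]
      have "(LINT t|lborel. g t) = 9 * C * e * (LINT t|lborel. exp (- (1 / 8) * t\<^sup>2)) + B * (LINT t|lborel. exp (- (e\<^sup>2 / 4) * t\<^sup>2))"
        unfolding g_def Bochner_Integration.integral_mult_right_zero[symmetric]
        by (intro Bochner_Integration.integral_add integrable_mult_right i1(1) i2(1)) (use e in auto)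
      also have "(LINT t|lborel. exp (- (1 / 8) * t\<^sup>2)) = sqrt (pi / (1 / 8))" by (rule i1(2)) simp
      also have "(LINT t|lborel. exp (- (e\<^sup>2 / 4) * t\<^sup>2)) = sqrt (pi / (e\<^sup>2 / 4))" by (rule i2(2)) (use e in simp)
      finally show ?thesis .
    qed
    \<comment> \<open>The Gaussian integral is of order \<open>1 / e\<close>, so \<open>B\<close>
      has to be of order \<open>e\<^sup>2\<close>: one factor \<open>e\<close> comes from
      \<open>K\<close>, the other from \<open>1 / sqrt n \<le> e\<close>, where
      \<open>\<delta> < 1\<close> enters.\<close>
    have k3: "B * sqrt (pi / (e\<^sup>2 / 4)) \<le> 2 / r * K * sqrt (4 * pi) * e"
    proof -
      have "sqrt (pi / (e\<^sup>2 / 4)) = sqrt (4 * pi) / e" using e by (simp add: real_sqrt_divide real_sqrt_mult)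
      moreover have "B \<le> 2 / r * K * e\<^sup>2"
      proof -
        have e2: "e\<^sup>2 = real n powr (- \<delta>)" using n by (simp add: e_def power2_eq_square powr_add[symmetric])
        have "(e * T)\<^sup>2 / 4 = r\<^sup>2 / 4 * real n powr (1 - \<delta>)"
          using n by (simp add: power_mult_distrib e2 T_def powr_diff powr_minus field_simps)
        then have "real n powr (\<delta> / 2) * exp (- (e * T)\<^sup>2 / 4) \<le> K" using K(2)[of n] by simp
        then have "real n powr (- \<delta> / 2) * (real n powr (\<delta> / 2) * exp (- (e * T)\<^sup>2 / 4)) \<le> real n powr (- \<delta> / 2) * K"
          by (intro mult_left_mono) auto
        then have "exp (- (e * T)\<^sup>2 / 4) \<le> e * K"
          using n by (simp add: mult.assoc[symmetric] powr_add[symmetric] e_def)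
        moreover have "1 / sqrt (real n) \<le> e"
        proof -
          have "1 / sqrt (real n) = real n powr (- 1 / 2)"
            using n by (simp add: powr_minus powr_half_sqrt[symmetric] field_simps del: powr_half_sqrt)
          also have "\<dots> \<le> e" unfolding e_def using n \<delta> by (intro powr_mono) auto
          finally show ?thesis .
        qed
        ultimately have "(2 / r * (1 / sqrt (real n))) * exp (- (e * T)\<^sup>2 / 4) \<le> (2 / r * e) * (e * K)"
          using r e by (intro mult_mono mult_left_mono) auto
        then show ?thesis by (simp add: B_def T_def power2_eq_square mult_ac)
      qed
      ultimately show ?thesis using e mult_right_mono[of B "2 / r * K * e\<^sup>2" "sqrt (4 * pi) / e"]
        by (simp add: power2_eq_square mult_ac)
    qed
    have "(1 / pi) * (LINT t|lborel. g t) \<le> (1 / pi) * (9 * C * e * sqrt (pi / (1 / 8)) + 2 / r * K * sqrt (4 * pi) * e)"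
      unfolding k2 using k3 by (intro mult_left_mono add_left_mono) auto
    also have "\<dots> = A * e" by (simp add: A_def algebra_simps)
    finally have sm: "\<bar>cdf (gauss_smooth W e) y - cdf (gauss_smooth std_normal_distribution e) y\<bar> \<le> A * e" for y
      using k1[of y] by linarith
    show "\<bar>cdf W x - std_normal_cdf x\<bar> \<le> (2 * A + 3) * real n powr (- \<delta> / 2)"
      using gauss_smoothing[OF W e(1) sm, of x] by (simp add: e_def algebra_simps)
  qed
qed

end

section \<open>Lower bound\<close>

text \<open>The power and the factor \<open>\<bar>x\<bar>\<close> together are at most
  \<open>exp (K * \<bar>x\<bar>)\<close>, and completing the square gives
  \<open>K * \<bar>x\<bar> \<le> K\<^sup>2 + x\<^sup>2 / 4\<close>, leaving a quarter of the
  Gaussian exponent.\<close>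

lemma integrable_powr_gauss:
  fixes m :: real
  shows "integrable lborel (\<lambda>x::real. \<bar>x\<bar> * exp (- x\<^sup>2 / 2) * (1 + \<bar>x\<bar>) powr m)"
proof (rule Bochner_Integration.integrable_bound)
  define K where "K = max m 0 + 1"
  show "integrable lborel (\<lambda>x::real. exp (K\<^sup>2) * exp (- (1 / 4) * x\<^sup>2))"
    by (intro integrable_mult_right integral_exp_neg_square) simp
  show "AE x in lborel. norm (\<bar>x\<bar> * exp (- x\<^sup>2 / 2) * (1 + \<bar>x\<bar>) powr m) \<le> norm (exp (K\<^sup>2) * exp (- (1 / 4) * x\<^sup>2))"
  proof (rule AE_I2)
    fix x :: real
    have "(1 + \<bar>x\<bar>) powr m \<le> (1 + \<bar>x\<bar>) powr (max m 0)" by (intro powr_mono) auto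
    also have "\<dots> \<le> exp \<bar>x\<bar> powr (max m 0)" by (intro powr_mono2) auto
    also have "\<dots> = exp (max m 0 * \<bar>x\<bar>)" by (simp add: powr_def)
    finally have 1: "(1 + \<bar>x\<bar>) powr m \<le> exp (max m 0 * \<bar>x\<bar>)" .
    have 2: "\<bar>x\<bar> \<le> exp \<bar>x\<bar>" using exp_ge_add_one_self[of "\<bar>x\<bar>"] by linarith
    have "\<bar>x\<bar> * exp (- x\<^sup>2 / 2) * (1 + \<bar>x\<bar>) powr m \<le> exp \<bar>x\<bar> * exp (- x\<^sup>2 / 2) * exp (max m 0 * \<bar>x\<bar>)"
      by (intro mult_mono 1 2) auto
    also have "\<dots> = exp (K * \<bar>x\<bar> - x\<^sup>2 / 2)" by (simp add: exp_add[symmetric] K_def algebra_simps)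
    also have "\<dots> \<le> exp (K\<^sup>2 + - (1 / 4) * x\<^sup>2)"
      using zero_le_power2[of "K - \<bar>x\<bar> / 2"] by (simp add: power2_diff power_divide)
    finally show "norm (\<bar>x\<bar> * exp (- x\<^sup>2 / 2) * (1 + \<bar>x\<bar>) powr m) \<le> norm (exp (K\<^sup>2) * exp (- (1 / 4) * x\<^sup>2))"
      by (simp add: exp_add[symmetric] abs_mult)
  qed
qed measurable

lemma integrable_ident_gauss: "integrable lborel (\<lambda>x::real. x * exp (- x\<^sup>2 / 2))"
  by (rule Bochner_Integration.integrable_bound[OF integrable_powr_gauss[of 0]]) (auto simp: abs_mult)

text \<open>The fundamental theorem of calculus, with an indicator in place of the integration limit
  so that the order of integration can later be exchanged.\<close>

lemma exp_neg_square_eq_integral: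
  fixes z :: real
  shows   "exp (- z\<^sup>2 / 2) = (LINT x|lborel. x * exp (- x\<^sup>2 / 2) * indicator {z..} x)"
proof -
  let ?f = "\<lambda>x::real. x * exp (- x\<^sup>2 / 2)" and ?F = "\<lambda>x::real. - exp (- x\<^sup>2 / 2)"
  have "(LBINT x=ereal z..\<infinity>. ?f x) = 0 - ?F z"
  proof (rule interval_integral_FTC_integrable)
    show "(?F has_vector_derivative ?f x) (at x)" for x
      unfolding has_real_derivative_iff_has_vector_derivative[symmetric]
      by (auto intro!: derivative_eq_intros)
    show "set_integrable lborel (einterval (ereal z) \<infinity>) ?f"
      unfolding set_integrable_def by (intro integrable_mult_indicator integrable_ident_gauss) auto
    show "((?F \<circ> real_of_ereal) \<longlongrightarrow> ?F z) (at_right (ereal z))"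
      unfolding comp_def ereal_tendsto_simps by (intro tendsto_intros) simp
    have "(?F \<longlongrightarrow> 0) at_top" by real_asymp
    then show "((?F \<circ> real_of_ereal) \<longlongrightarrow> 0) (at_left \<infinity>)" by (simp add: ereal_tendsto_simps)
  qed auto
  also have "(LBINT x=ereal z..\<infinity>. ?f x) = (LINT x|lborel. indicator {z<..} x *\<^sub>R ?f x)"
    by (simp add: interval_lebesgue_integral_def set_lebesgue_integral_def)
  \<comment> \<open>The endpoint is a null set; the closed half-line is preferred because
    \<open>z \<le> x\<close> is the event that defines \<open>cdf M x\<close>.\<close>
  also have "\<dots> = (LINT x|lborel. ?f x * indicator {z..} x)"
    by (intro integral_cong_AE) (use AE_lborel_singleton[of z] in \<open>auto simp: indicator_def elim!: eventually_mono\<close>)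
  finally show ?thesis by simp
qed

text \<open>Integration by parts in the form of Fubini: integrating the indicator of
  \<open>z \<le> x\<close> over \<open>z\<close> first produces the cdf.\<close>

lemma (in real_distribution) expectation_gauss_eq_cdf:
  "(LINT z|M. exp (- z\<^sup>2 / 2)) = (LINT x|lborel. x * exp (- x\<^sup>2 / 2) * cdf M x)"
proof -
  interpret P: pair_sigma_finite lborel M ..
  let ?f = "\<lambda>x z::real. x * exp (- x\<^sup>2 / 2) * indicator {z..} x"
  have [measurable_cong]: "sets (lborel \<Otimes>\<^sub>M M) = sets (borel \<Otimes>\<^sub>M borel)"
    by (intro sets_pair_measure_cong) auto
  have ind: "(LINT z|M. a * indicator {z..} x) = a * cdf M x" for a x
  proof -
    have "(LINT z|M. a * indicator {z..} x) = (LINT z|M. a * indicator {..x} z)"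
      by (intro Bochner_Integration.integral_cong) (auto simp: indicator_def)
    then show ?thesis by (simp add: cdf_def)
  qed
  have [measurable]: "case_prod ?f \<in> borel_measurable (lborel \<Otimes>\<^sub>M M)"
  proof -
    have "(\<lambda>p. fst p * exp (- (fst p)\<^sup>2 / 2) * indicator {p. snd p \<le> fst p} p) \<in> borel_measurable (borel \<Otimes>\<^sub>M borel :: (real \<times> real) measure)"
      by measurable
    then show ?thesis by (simp add: split_beta' indicator_def cong: measurable_cong_sets)
  qed
  have [measurable]: "cdf M \<in> borel_measurable borel"
    by (auto intro!: borel_measurable_mono simp: mono_def cdf_nondecreasing)
  have int: "integrable (lborel \<Otimes>\<^sub>M M) (case_prod ?f)"
  proof (rule P.Fubini_integrable)
    have "integrable lborel (\<lambda>x. \<bar>x * exp (- x\<^sup>2 / 2)\<bar> * cdf M x)"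
      by (rule Bochner_Integration.integrable_bound[OF integrable_ident_gauss])
        (auto simp: abs_mult cdf_bounded_prob cdf_nonneg mult_left_le)
    then show "integrable lborel (\<lambda>x. LINT z|M. norm (case_prod ?f (x, z)))"
      using ind[of 1] by (simp add: abs_mult)
    show "AE x in lborel. integrable M (\<lambda>z. case_prod ?f (x, z))"
    proof (rule AE_I2)
      fix x :: real
      have "(\<lambda>z. indicat_real {z..} x) = indicator {..x}" by (auto simp: indicator_def)
      moreover have "integrable M (indicat_real {..x})" by (rule integrable_const_bound[of _ 1]) auto
      ultimately have "integrable M (\<lambda>z. indicat_real {z..} x)" by (simp only:)
      then show "integrable M (\<lambda>z. case_prod ?f (x, z))" by simp
    qed
  qed measurable
  have "(LINT z|M. exp (- z\<^sup>2 / 2)) = (LINT z|M. (LINT x|lborel. ?f x z))"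
    by (intro Bochner_Integration.integral_cong refl exp_neg_square_eq_integral)
  also have "\<dots> = (LINT x|lborel. (LINT z|M. ?f x z))"
    by (rule P.Fubini_integral[OF int])
  also have "\<dots> = (LINT x|lborel. x * exp (- x\<^sup>2 / 2) * cdf M x)" by (simp only: ind)
  finally show ?thesis .
qed

text \<open>Parseval's identity: \<open>exp (- z\<^sup>2 / 2)\<close> is the normal characteristic
  function at \<open>z\<close>, and Fubini moves the transform onto \<open>M\<close>.\<close>

lemma (in real_distribution) expectation_gauss_eq_char:
  assumes "char M = (\<lambda>t. of_real (f t))"
  shows "(LINT z|M. exp (- z\<^sup>2 / 2)) = (LINT t|std_normal_distribution. f t)"
proof -
  interpret pair_prob_space M std_normal_distribution by (rule pair_gauss)
  have int: "integrable (M \<Otimes>\<^sub>M std_normal_distribution) (\<lambda>(z, t). iexp (z * t))"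
    by (auto intro!: P.integrable_const_bound[of _ 1] simp: split_beta' simp del: of_real_mult)
  have "of_real (LINT z|M. exp (- z\<^sup>2 / 2)) = (CLINT z|M. char std_normal_distribution z)"
    by (simp add: char_std_normal_distribution)
  also have "\<dots> = (CLINT z|M. (CLINT t|std_normal_distribution. iexp (z * t)))"
    by (simp add: char_def)
  also have "\<dots> = (CLINT t|std_normal_distribution. (CLINT z|M. iexp (z * t)))"
    using Fubini_integral[OF int] by simp
  also have "\<dots> = (CLINT t|std_normal_distribution. char M t)" by (simp add: char_def mult.commute)
  also have "\<dots> = of_real (LINT t|std_normal_distribution. f t)" by (simp add: assms)
  finally show ?thesis by (simp only: of_real_eq_iff)
qed

context heavy_tailed_distribution begin

lemma sum_cf_measurable [measurable]: "sum_cf n \<in> borel_measurable borel"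
proof -
  have "cf = (\<lambda>s. Re (char D s))" by (simp add: char_eq_cf)
  then have "cf \<in> borel_measurable borel" by simp
  then show ?thesis unfolding sum_cf_def by measurable
qed

text \<open>The fixed window \<open>\<bar>t\<bar> \<le> r\<close> already yields the rate. Up to
  \<open>r * sqrt n\<close> the integrand is nonnegative, and beyond that it is at least
  \<open>- 2\<close> on an event of normal probability \<open>O(1 / n)\<close>.\<close>

lemma sum_cf_gauss_lower:
  obtains c where "0 < c"
    "\<forall>\<^sub>F n in sequentially. c * real n powr (- (\<alpha> - 2) / 2)
       \<le> (LINT t|std_normal_distribution. sum_cf n t - exp (- t\<^sup>2 / 2))"
proof -
  interpret N: real_distribution std_normal_distribution by (rule real_dist_normal_dist)
  obtain r c where r: "0 < r" and c: "0 < c" and low: "\<And>n t. 1 \<le> n \<Longrightarrow> \<bar>t\<bar> \<le> r * sqrt (real n) \<Longrightarrow>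
       c * real n powr (- (\<alpha> - 2) / 2) * (\<bar>t\<bar> powr \<alpha> * exp (- t\<^sup>2 / 2)) \<le> sum_cf n t - exp (- t\<^sup>2 / 2)"
    using sum_cf_lower by blast
  define k where "k t = indicator {t. \<bar>t\<bar> \<le> r} t * (\<bar>t\<bar> powr \<alpha> * exp (- t\<^sup>2 / 2))" for t :: real
  have [measurable]: "k \<in> borel_measurable borel" unfolding k_def by measurable
  have k0: "0 \<le> k t" for t by (simp add: k_def)
  have kint: "integrable std_normal_distribution k"
  proof (rule N.integrable_const_bound[of _ "r powr \<alpha> * 1"])
    have "k t \<le> r powr \<alpha> * 1" for t
    proof (cases "\<bar>t\<bar> \<le> r")
      case True
      then have "\<bar>t\<bar> powr \<alpha> * exp (- t\<^sup>2 / 2) \<le> r powr \<alpha> * 1"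
        using alpha by (intro mult_mono powr_mono2) auto
      then show ?thesis using True by (simp add: k_def)
    qed (simp add: k_def)
    then show "AE t in std_normal_distribution. norm (k t) \<le> r powr \<alpha> * 1" using k0 by auto
  qed simp
  define \<kappa> where "\<kappa> = (LINT t|std_normal_distribution. k t)"
  have \<kappa>: "0 < \<kappa>"
  proof -
    \<comment> \<open>A vanishing integral would make \<open>k\<close> zero almost everywhere,
      although it is positive on \<open>{0<..<r}\<close>.\<close>
    have "\<kappa> \<noteq> 0"
    proof
      assume "\<kappa> = 0"
      then have "AE t in std_normal_distribution. k t = 0"
        unfolding \<kappa>_def using integral_nonneg_eq_0_iff_AE[OF kint] k0 by simp
      then have "AE t in lborel. k t = 0"
        by (subst (asm) AE_density) (auto simp: normal_density_pos)
      then have "AE t in lborel. t \<notin> {0<..<r}"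
        by eventually_elim (auto simp: k_def)
      then have "{0<..<r} \<in> null_sets lborel" by (subst (asm) AE_iff_null_sets[symmetric]) auto
      then show False using r by (auto simp: null_sets_def)
    qed
    moreover have "0 \<le> \<kappa>" unfolding \<kappa>_def using k0 by simp
    ultimately show ?thesis by simp
  qed
  show thesis
  proof
    show "0 < c * \<kappa> / 2" using c \<kappa> by simp
    \<comment> \<open>Since \<open>(\<alpha> - 2) / 2 < 1\<close>, half of the main term eventually
      pays for the far range.\<close>
    have "\<forall>\<^sub>F n in sequentially. 2 / (r\<^sup>2 * real n) \<le> c * \<kappa> / 2 * real n powr (- (\<alpha> - 2) / 2)"
      using r c \<kappa> alpha by real_asymp
    then show "\<forall>\<^sub>F n in sequentially. c * \<kappa> / 2 * real n powr (- (\<alpha> - 2) / 2)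
       \<le> (LINT t|std_normal_distribution. sum_cf n t - exp (- t\<^sup>2 / 2))"
      using eventually_ge_at_top[of 1]
    proof eventually_elim
      case (elim n)
      define a where "a = c * real n powr (- (\<alpha> - 2) / 2)"
      have a: "0 \<le> a" using c by (simp add: a_def)
      let ?S = "{t::real. r * sqrt (real n) < \<bar>t\<bar>}"
      have Sint: "integrable std_normal_distribution (indicat_real ?S)"
        by (rule N.integrable_const_bound[of _ 1]) auto
      have "a * \<kappa> - 2 * measure std_normal_distribution ?S = (LINT t|std_normal_distribution. a * k t - 2 * indicator ?S t)"
        unfolding \<kappa>_def using kint Sint by simp
      also have "\<dots> \<le> (LINT t|std_normal_distribution. sum_cf n t - exp (- t\<^sup>2 / 2))"
      proof (rule integral_mono)
        show "integrable std_normal_distribution (\<lambda>t. a * k t - 2 * indicator ?S t)" using kint Sint by simp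
        show "integrable std_normal_distribution (\<lambda>t. sum_cf n t - exp (- t\<^sup>2 / 2))"
          by (rule N.integrable_const_bound[of _ 2]) (simp_all add: sum_cf_diff_le_2[simplified])
        fix t
        show "a * k t - 2 * indicator ?S t \<le> sum_cf n t - exp (- t\<^sup>2 / 2)"
        proof (cases "t \<in> ?S")
          case True
          have "r * 1 \<le> r * sqrt (real n)" using r elim by (intro mult_left_mono) auto
          then have "k t = 0" using True by (simp add: k_def)
          then show ?thesis using True sum_cf_diff_le_2[of n t] by (simp add: abs_le_iff)
        next
          case False
          have "a * k t \<le> a * (\<bar>t\<bar> powr \<alpha> * exp (- t\<^sup>2 / 2))"
            using a by (intro mult_left_mono) (auto simp: k_def indicator_def)
          also have "\<dots> \<le> sum_cf n t - exp (- t\<^sup>2 / 2)"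
            unfolding a_def using elim False by (intro low) auto
          finally show ?thesis using False by simp
        qed
      qed
      finally have 1: "a * \<kappa> - 2 * measure std_normal_distribution ?S \<le> (LINT t|std_normal_distribution. sum_cf n t - exp (- t\<^sup>2 / 2))" .
      have "measure std_normal_distribution ?S \<le> 1 / (r * sqrt (real n))\<^sup>2"
        using r elim by (intro std_normal_tail_le) auto
      then have "2 * measure std_normal_distribution ?S \<le> 2 / (r\<^sup>2 * real n)" by (simp add: power_mult_distrib)
      then show ?case using 1 elim(1) by (simp add: a_def field_simps)
    qed
  qed
qed

end

section \<open>Rates for weighted distances\<close>

text \<open>Dyadic decomposition: a shell near \<open>2 ^ k\<close> contributes order
  \<open>2 powr (p * k)\<close> times a tail of order \<open>2 powr (- \<alpha> * k)\<close>, and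
  the geometric ratio \<open>2 powr (p - \<alpha>)\<close> is below \<open>1\<close>.\<close>

lemma (in real_distribution) integrable_abs_powr:
  fixes \<alpha> p :: real
  assumes p: "0 < p" "p < \<alpha>"
    and tail_upper: "\<exists>C. \<exists>x0>0. \<forall>x\<ge>x0. measure M {y. x < \<bar>y\<bar>} \<le> C * x powr (- \<alpha>)"
  shows "integrable M (\<lambda>x. \<bar>x\<bar> powr p)"
proof -
  obtain C0 x0 where x0: "0 < x0" and C0: "\<And>x. x0 \<le> x \<Longrightarrow> measure M {y. x < \<bar>y\<bar>} \<le> C0 * x powr (- \<alpha>)"
    using tail_upper by blast
  \<comment> \<open>The second entry extends the tail bound to all positive \<open>x\<close>: below
    \<open>x0\<close> the right side is then at least \<open>1\<close>.\<close>
  define C where "C = max C0 (x0 powr \<alpha>)"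
  have C: "0 \<le> C" by (simp add: C_def le_max_iff_disj)
  have tail: "measure M {y. x < \<bar>y\<bar>} \<le> C * x powr (- \<alpha>)" if "0 < x" for x
  proof (cases "x0 \<le> x")
    case True
    have "C0 * x powr (- \<alpha>) \<le> C * x powr (- \<alpha>)" by (intro mult_right_mono) (auto simp: C_def)
    then show ?thesis using C0[OF True] by linarith
  next
    case False
    have "measure M {y. x < \<bar>y\<bar>} \<le> 1" by simp
    also have "1 = x0 powr \<alpha> * x0 powr (- \<alpha>)" using x0 by (simp add: powr_add[symmetric])
    also have "\<dots> \<le> C * x powr (- \<alpha>)"
      using False that p C by (intro mult_mono powr_mono2') (auto simp: C_def)
    finally show ?thesis .
  qed
  define a :: "nat \<Rightarrow> real" where "a k = 2 powr (p * (real k + 1))" for k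
  have dyadic_tail: "a k * measure M {y. 2 ^ k / 2 < \<bar>y\<bar>} \<le> C * 2 powr (p + \<alpha>) * (2 powr (p - \<alpha>)) ^ k" for k
  proof -
    have pos: "0 < (2::real) powr (p - \<alpha>)" by simp
    have half: "2 ^ k / 2 = (2::real) powr (real k - 1)"
      by (simp add: powr_diff powr_realpow)
    have "a k * measure M {y. 2 ^ k / 2 < \<bar>y\<bar>} \<le> a k * (C * (2 ^ k / 2) powr (- \<alpha>))"
      by (intro mult_left_mono tail) (auto simp: a_def)
    also have "a k * (C * (2 ^ k / 2) powr (- \<alpha>)) = C * 2 powr (p + \<alpha>) * (2 powr (p - \<alpha>)) ^ k"
    proof -
      have "p * (real k + 1) + (real k - 1) * (- \<alpha>) = (p + \<alpha>) + (p - \<alpha>) * real k"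
        by (simp add: algebra_simps)
      then have exps: "2 powr (p * (real k + 1)) * 2 powr ((real k - 1) * (- \<alpha>)) = 2 powr (p + \<alpha>) * (2 powr (p - \<alpha>)) ^ k"
        unfolding powr_realpow[OF pos, symmetric] powr_powr powr_add[symmetric] by (rule arg_cong)
      have "a k * (C * (2 ^ k / 2) powr (- \<alpha>)) = C * (2 powr (p * (real k + 1)) * 2 powr ((real k - 1) * (- \<alpha>)))"
        unfolding half a_def powr_powr by (rule mult.left_commute)
      then show ?thesis unfolding exps mult.assoc[symmetric] .
    qed
    finally show ?thesis .
  qed
  have summ: "summable (\<lambda>k. a k * measure M {y. 2 ^ k / 2 < \<bar>y\<bar>})"
  proof (rule summable_comparison_test')
    have "norm ((2::real) powr (p - \<alpha>)) < 1" using p by (simp add: powr_less_one)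
    then show "summable (\<lambda>k. C * 2 powr (p + \<alpha>) * (2 powr (p - \<alpha>)) ^ k)"
      by (intro summable_mult summable_geometric)
    show "norm (a k * measure M {y. 2 ^ k / 2 < \<bar>y\<bar>}) \<le> C * 2 powr (p + \<alpha>) * (2 powr (p - \<alpha>)) ^ k" if "0 \<le> k" for k
      using dyadic_tail[of k] by (simp add: a_def)
  qed
  \<comment> \<open>The summand \<open>1\<close> covers \<open>\<bar>x\<bar> < 1\<close>. The
    threshold is \<open>2 ^ k / 2\<close> rather than \<open>2 ^ k\<close> because the tail event is
    strict and \<open>\<bar>x\<bar>\<close> may equal \<open>2 ^ k\<close>.\<close>
  have pt: "ennreal (\<bar>x\<bar> powr p) \<le> 1 + (\<Sum>k. ennreal (a k) * indicator {y. 2 ^ k / 2 < \<bar>y\<bar>} x)" for x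
  proof -
    define k where "k = (LEAST k. \<bar>x\<bar> < 2 ^ k)"
    have k: "\<bar>x\<bar> < 2 ^ k" unfolding k_def by (rule LeastI_ex) (simp add: real_arch_pow)
    show ?thesis
    proof (cases k)
      case 0
      then have "\<bar>x\<bar> powr p \<le> 1" using k p powr_le1[of p "\<bar>x\<bar>"] by simp
      then have "ennreal (\<bar>x\<bar> powr p) \<le> 1" using ennreal_leI by fastforce
      then show ?thesis by (rule add_increasing2[OF zero_le])
    next
      case (Suc j)
      have "\<not> \<bar>x\<bar> < 2 ^ j" using not_less_Least[of j "\<lambda>k. \<bar>x\<bar> < 2 ^ k"] Suc by (simp add: k_def)
      then have j: "2 ^ j / 2 < \<bar>x\<bar>" using zero_less_power[of "2::real" j] by linarith
      have "\<bar>x\<bar> powr p \<le> (2 ^ Suc j) powr p" using k Suc p by (intro powr_mono2) auto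
      also have "\<dots> = a j" by (simp add: a_def powr_realpow[symmetric] powr_powr mult.commute[of p] add.commute del: power_Suc)
      finally have "ennreal (\<bar>x\<bar> powr p) \<le> (\<Sum>k\<in>{j}. ennreal (a k) * indicator {y. 2 ^ k / 2 < \<bar>y\<bar>} x)"
        using j by (simp add: ennreal_leI)
      also have "\<dots> \<le> (\<Sum>k. ennreal (a k) * indicator {y. 2 ^ k / 2 < \<bar>y\<bar>} x)"
        by (rule sum_le_suminf) auto
      finally show ?thesis by (simp add: add_increasing)
    qed
  qed
  have "(\<integral>\<^sup>+x. ennreal (\<bar>x\<bar> powr p) \<partial>M) \<le> (\<integral>\<^sup>+x. 1 + (\<Sum>k. ennreal (a k) * indicator {y. 2 ^ k / 2 < \<bar>y\<bar>} x) \<partial>M)"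
    by (intro nn_integral_mono pt)
  also have "\<dots> = 1 + (\<Sum>k. ennreal (a k) * emeasure M {y. 2 ^ k / 2 < \<bar>y\<bar>})"
    using emeasure_space_1 by (simp add: nn_integral_add nn_integral_suminf nn_integral_cmult_indicator)
  also have "\<dots> = 1 + (\<Sum>k. ennreal (a k * measure M {y. 2 ^ k / 2 < \<bar>y\<bar>}))"
    by (simp add: emeasure_eq_measure ennreal_mult a_def)
  also have "\<dots> = 1 + ennreal (\<Sum>k. a k * measure M {y. 2 ^ k / 2 < \<bar>y\<bar>})"
    by (subst suminf_ennreal2[OF _ summ]) (auto simp: a_def)
  also have "\<dots> < \<infinity>" by (simp add: ennreal_add_less_top)
  finally show ?thesis by (intro integrableI_nonneg) auto
qed

section \<open>From asymptotic bounds to rates for all sample sizes\<close>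

text \<open>The finitely many indices before the asymptotic regime are covered by the least of their
  positive values, as \<open>real n powr (- \<beta>) \<le> 1\<close>.\<close>

lemma positive_power_lower_bound:
  fixes a :: "nat \<Rightarrow> real"
  assumes "\<And>n. 1 \<le> n \<Longrightarrow> 0 < a n" and "0 < c" "0 \<le> \<beta>"
    and "\<forall>\<^sub>F n in sequentially. c * real n powr (- \<beta>) \<le> a n"
  shows "\<exists>c>0. \<forall>n\<ge>1. c * real n powr (- \<beta>) \<le> a n"
proof -
  obtain N where N: "\<And>n. N \<le> n \<Longrightarrow> c * real n powr (- \<beta>) \<le> a n"
    using assms(4) unfolding eventually_sequentially by blast
  define d where "d = Min (insert c (a ` {1..N}))"
  have d: "0 < d" "d \<le> c" using assms(1,2) by (auto simp: d_def)
  have d_le: "d \<le> a n" if "n \<in> {1..N}" for n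
    unfolding d_def using that by (intro Min_le) auto
  have "d * real n powr (- \<beta>) \<le> a n" if "1 \<le> n" for n
  proof (cases "n \<le> N")
    case True
    have "real n powr (- \<beta>) \<le> 1" using that assms(3) powr_mono[of "- \<beta>" 0 "real n"] by simp
    then have "d * real n powr (- \<beta>) \<le> d * 1" using d by (intro mult_left_mono) auto
    then show ?thesis using d_le[of n] True that by simp
  next
    case False
    have "d * real n powr (- \<beta>) \<le> c * real n powr (- \<beta>)" using d by (intro mult_right_mono) auto
    then show ?thesis using N[of n] False by linarith
  qed
  then show ?thesis using d by blast
qed

text \<open>After taking logarithms and dividing by \<open>ln n\<close> the constants disappear in
  the limit, so upper exponents \<open>s\<close> arbitrarily close to \<open>r\<close>
  suffice.\<close>

lemma power_rateI:
  assumes pos: "\<exists>c>0. \<forall>n\<ge>1. c * real n powr (- r) \<le> a n"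
    and up: "\<And>s. 0 < s \<Longrightarrow> s < r \<Longrightarrow> \<exists>C. \<forall>n\<ge>1. a n \<le> C * real n powr (- s)"
    and r: "0 < r"
  shows "power_rate a r"
proof -
  obtain c where c: "0 < c" "\<And>n. 1 \<le> n \<Longrightarrow> c * real n powr (- r) \<le> a n" using pos by blast
  have a: "0 < a n" if "1 \<le> n" for n
  proof -
    have "0 < c * real n powr (- r)" using c that by simp
    then show ?thesis using c(2)[OF that] by linarith
  qed
  have "(\<lambda>n. ln (a n) / ln (real n)) \<longlonglongrightarrow> - r"
  proof (rule order_tendstoI)
    fix y :: real assume y: "y < - r"
    have "\<forall>\<^sub>F n in sequentially. y < (ln c + - r * ln (real n)) / ln (real n)"
      using y by real_asymp
    then show "\<forall>\<^sub>F n in sequentially. y < ln (a n) / ln (real n)"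
      using eventually_gt_at_top[of 1]
    proof eventually_elim
      case (elim n)
      have "ln (c * real n powr (- r)) \<le> ln (a n)" using c a elim by (intro ln_mono) auto
      moreover have "ln (c * real n powr (- r)) = ln c + - r * ln (real n)"
        using c elim by (simp add: ln_mult ln_powr)
      ultimately have "(ln c + - r * ln (real n)) / ln (real n) \<le> ln (a n) / ln (real n)"
        using elim by (intro divide_right_mono) auto
      then show ?case using elim by linarith
    qed
  next
    fix y :: real assume y: "- r < y"
    \<comment> \<open>Any \<open>s\<close> strictly between \<open>max 0 (- y)\<close> and
      \<open>r\<close> would do; these are midpoints.\<close>
    define s where "s = max (r / 2) ((r - y) / 2)"
    have s: "0 < s" "s < r" "- s < y" using y r by (auto simp: s_def max_def field_simps)
    obtain C where C: "\<And>n. 1 \<le> n \<Longrightarrow> a n \<le> C * real n powr (- s)" using up[OF s(1,2)] by blast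
    have C0: "0 < C" using C[of 1] a[of 1] by simp
    have "\<forall>\<^sub>F n in sequentially. (ln C + - s * ln (real n)) / ln (real n) < y"
      using s by real_asymp
    then show "\<forall>\<^sub>F n in sequentially. ln (a n) / ln (real n) < y"
      using eventually_gt_at_top[of 1]
    proof eventually_elim
      case (elim n)
      have "ln (a n) \<le> ln (C * real n powr (- s))" using C a elim by (intro ln_mono) auto
      moreover have "ln (C * real n powr (- s)) = ln C + - s * ln (real n)"
        using C0 elim by (simp add: ln_mult ln_powr)
      ultimately have "ln (a n) / ln (real n) \<le> (ln C + - s * ln (real n)) / ln (real n)"
        using elim by (intro divide_right_mono) auto
      then show ?case using elim by linarith
    qed
  qed
  then show ?thesis using a by (simp add: power_rate_def)
qed

lemma not_bigo_of_power_lower_bound: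
  assumes "\<exists>c>0. \<forall>n\<ge>1. c * real n powr (- r) \<le> a n" and "r < s"
  shows "a \<notin> O(\<lambda>n. real n powr (- s))"
proof
  assume "a \<in> O(\<lambda>n. real n powr (- s))"
  then obtain C where C: "0 < C" "\<forall>\<^sub>F n in sequentially. norm (a n) \<le> C * norm (real n powr (- s))"
    by (rule landau_o.bigE)
  obtain c where c: "0 < c" "\<And>n. 1 \<le> n \<Longrightarrow> c * real n powr (- r) \<le> a n" using assms by blast
  have "\<forall>\<^sub>F n in sequentially. C * real n powr (- s) < c * real n powr (- r)"
    using c C assms(2) by real_asymp
  then have "\<forall>\<^sub>F n in sequentially. False"
    using C(2) eventually_ge_at_top[of 1]
  proof eventually_elim
    case (elim n)
    then show ?case using c(2)[of n] by simp
  qed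
  then show False by simp
qed

text \<open>Linear growth outside \<open>{- t0..t0}\<close> and boundedness inside combine to
  \<open>1 + h t \<le> K * (1 + \<bar>t\<bar>)\<close>, so the weight decays at most like the power
  \<open>q\<close>.\<close>

lemma regular_exhaustion_weight:
  assumes h: "regular_exhaustion h" and q: "0 < q"
  shows "poly_bounded_weight (\<lambda>t. (1 + h t) powr (- q))"
proof -
  obtain c2 t0 where c2: "0 < c2" "0 \<le> t0" "\<And>t. t0 \<le> \<bar>t\<bar> \<Longrightarrow> h t \<le> c2 * \<bar>t\<bar>"
    using h unfolding regular_exhaustion_def by blast
  have h0: "0 \<le> h t" for t using h unfolding regular_exhaustion_def by blast
  have [measurable]: "h \<in> borel_measurable borel" using h unfolding regular_exhaustion_def by blast
  have "bounded (h ` {- t0..t0})" using h unfolding regular_exhaustion_def by blast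
  then obtain B where B: "0 < B" "\<And>t. t \<in> {- t0..t0} \<Longrightarrow> norm (h t) \<le> B"
    unfolding bounded_pos by blast
  define K where "K = 1 + B + c2"
  have K: "0 < K" using B c2 by (simp add: K_def)
  have hK: "1 + h t \<le> K * (1 + \<bar>t\<bar>)" for t
  proof -
    have "h t \<le> B + c2 * \<bar>t\<bar>"
    proof (cases "t0 \<le> \<bar>t\<bar>")
      case True
      then show ?thesis using c2(3)[of t] B by linarith
    next
      case False
      then have "t \<in> {- t0..t0}" by auto
      then have "h t \<le> B" using B(2)[of t] by simp
      moreover have "0 \<le> c2 * \<bar>t\<bar>" using c2 by simp
      ultimately show ?thesis by linarith
    qed
    moreover have "0 \<le> (1 + B) * \<bar>t\<bar>" using B by simp
    ultimately show ?thesis using c2 by (simp add: K_def algebra_simps)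
  qed
  have low: "inverse (K powr q) * (1 + \<bar>t\<bar>) powr (- q) \<le> (1 + h t) powr (- q)" for t
  proof -
    have "inverse (K powr q) * (1 + \<bar>t\<bar>) powr (- q) = (K * (1 + \<bar>t\<bar>)) powr (- q)"
      using K by (simp add: powr_mult powr_minus)
    also have "\<dots> \<le> (1 + h t) powr (- q)"
      using hK[of t] h0[of t] q by (intro powr_mono2') auto
    finally show ?thesis .
  qed
  have le1: "(1 + h t) powr (- q) \<le> 1" "0 < (1 + h t) powr (- q)" for t
    using h0[of t] q powr_mono[of "- q" 0 "1 + h t"] by (auto simp: add_nonneg_eq_0_iff)
  have Kq: "0 < K powr q" using K by simp
  show ?thesis
    unfolding poly_bounded_weight_def
    by (intro conjI allI le1 exI[of _ "K powr q"] exI[of _ q] low Kq) measurable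
qed

section \<open>Distances between standardized sums and the normal law\<close>

text \<open>The laws of the standardized sums enter only through their characteristic functions,
  which keeps the underlying probability space out of the estimates.\<close>

locale heavy_tailed_sums = heavy_tailed_distribution +
  fixes W :: "nat \<Rightarrow> real measure"
  assumes W_dist: "1 \<le> n \<Longrightarrow> real_distribution (W n)"
    and char_W: "1 \<le> n \<Longrightarrow> char (W n) = (\<lambda>t. of_real (sum_cf n t))"
begin

lemma cdf_diff_le_1:
  assumes "1 \<le> n"
  shows "\<bar>cdf (W n) x - std_normal_cdf x\<bar> \<le> 1"
proof -
  interpret W: real_distribution "W n" by (rule W_dist) fact
  interpret N: real_distribution std_normal_distribution by (rule real_dist_normal_dist)
  show ?thesis
    using W.cdf_nonneg[of x] W.cdf_bounded_prob[of x] N.cdf_nonneg[of x] N.cdf_bounded_prob[of x]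
    unfolding std_normal_cdf_def by linarith
qed

lemma weighted_diff_le:
  assumes "1 \<le> n" and w: "\<And>x. 0 < w x \<and> w x \<le> 1"
  shows "w x * \<bar>cdf (W n) x - std_normal_cdf x\<bar> \<le> weighted_sup_dist w (cdf (W n)) std_normal_cdf"
  unfolding weighted_sup_dist_def
proof (rule cSUP_upper)
  have "w x * \<bar>cdf (W n) x - std_normal_cdf x\<bar> \<le> 1 * 1" for x
    using w[of x] cdf_diff_le_1[OF assms(1)] by (intro mult_mono) auto
  then show "bdd_above (range (\<lambda>t. w t * \<bar>cdf (W n) t - std_normal_cdf t\<bar>))"
    by (intro bdd_aboveI2[of _ _ 1]) auto
qed simp

text \<open>As the case of weight \<open>1\<close>, the unweighted distance inherits the results for
  weights.\<close>

lemma kolmogorov_dist_eq: "kolmogorov_dist F G = weighted_sup_dist (\<lambda>_. 1) F G"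
  by (simp add: kolmogorov_dist_def weighted_sup_dist_def)

lemma weighted_le_kolmogorov:
  assumes "1 \<le> n" and w: "\<And>x. 0 < w x \<and> w x \<le> 1"
  shows "weighted_sup_dist w (cdf (W n)) std_normal_cdf \<le> kolmogorov_dist (cdf (W n)) std_normal_cdf"
  unfolding weighted_sup_dist_def
proof (rule cSUP_least)
  fix x
  have "w x * \<bar>cdf (W n) x - std_normal_cdf x\<bar> \<le> 1 * \<bar>cdf (W n) x - std_normal_cdf x\<bar>"
    using w[of x] by (intro mult_right_mono) auto
  also have "\<dots> \<le> kolmogorov_dist (cdf (W n)) std_normal_cdf"
    unfolding kolmogorov_dist_eq by (rule weighted_diff_le[OF assms(1)]) auto
  finally show "w x * \<bar>cdf (W n) x - std_normal_cdf x\<bar> \<le> kolmogorov_dist (cdf (W n)) std_normal_cdf" .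
qed simp

lemma kolmogorov_upper:
  assumes "0 < \<delta>" "\<delta> < \<alpha> - 2"
  shows "\<exists>C. \<forall>n\<ge>1. kolmogorov_dist (cdf (W n)) std_normal_cdf \<le> C * real n powr (- \<delta> / 2)"
proof -
  have "integrable D (\<lambda>x. \<bar>x\<bar> powr (2 + \<delta>))" using assms by (intro integrable_abs_powr[OF _ _ tail_upper]) auto
  then obtain C where C: "\<And>n W x. 1 \<le> n \<Longrightarrow> real_distribution W \<Longrightarrow> char W = (\<lambda>t. of_real (sum_cf n t)) \<Longrightarrow>
     \<bar>cdf W x - std_normal_cdf x\<bar> \<le> C * real n powr (- \<delta> / 2)"
    using kolmogorov_upper_bound[of \<delta>] assms alpha by auto
  have "kolmogorov_dist (cdf (W n)) std_normal_cdf \<le> C * real n powr (- \<delta> / 2)" if "1 \<le> n" for n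
    unfolding kolmogorov_dist_def using that by (intro cSUP_least C W_dist char_W) auto
  then show ?thesis by blast
qed

text \<open>Equal cdfs would give equal characteristic functions, but by \<open>sum_cf_lower\<close>
  they differ at \<open>t = r\<close>, a point admissible for each \<open>n \<ge> 1\<close>.
  Positivity at every \<open>n\<close> is what extends the eventual lower bound to small
  \<open>n\<close>.\<close>

lemma weighted_sup_dist_pos:
  assumes n: "1 \<le> n" and w: "\<And>x. 0 < w x \<and> w x \<le> 1"
  shows "0 < weighted_sup_dist w (cdf (W n)) std_normal_cdf"
proof -
  interpret W: real_distribution "W n" by (rule W_dist) fact
  have "\<exists>x. cdf (W n) x \<noteq> std_normal_cdf x"
  proof (rule ccontr)
    assume "\<not> ?thesis"
    then have "W n = std_normal_distribution"
      by (intro cdf_unique W_dist n real_dist_normal_dist) (auto simp: std_normal_cdf_def)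
    then have eq: "sum_cf n t = exp (- t\<^sup>2 / 2)" for t
      using char_W[OF n] char_std_normal_distribution by (metis of_real_eq_iff)
    obtain r c where r: "0 < r" and c: "0 < c" and low: "\<And>n t. 1 \<le> n \<Longrightarrow> \<bar>t\<bar> \<le> r * sqrt (real n) \<Longrightarrow>
       c * real n powr (- (\<alpha> - 2) / 2) * (\<bar>t\<bar> powr \<alpha> * exp (- t\<^sup>2 / 2)) \<le> sum_cf n t - exp (- t\<^sup>2 / 2)"
      using sum_cf_lower by blast
    have "\<bar>r\<bar> \<le> r * sqrt (real n)" using r n by simp
    from low[OF n this] have "c * real n powr (- (\<alpha> - 2) / 2) * (\<bar>r\<bar> powr \<alpha> * exp (- r\<^sup>2 / 2)) \<le> 0" by (simp add: eq)
    moreover have "0 < c * real n powr (- (\<alpha> - 2) / 2) * (\<bar>r\<bar> powr \<alpha> * exp (- r\<^sup>2 / 2))"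
      using c r n by (intro mult_pos_pos) auto
    ultimately show False by linarith
  qed
  then obtain x where "cdf (W n) x \<noteq> std_normal_cdf x" by blast
  then have "0 < w x * \<bar>cdf (W n) x - std_normal_cdf x\<bar>" using w[of x] by simp
  then show ?thesis using weighted_diff_le[OF n, of w x, OF w] by linarith
qed

text \<open>The expectation of \<open>exp (- z\<^sup>2 / 2)\<close> is computed by characteristic
  functions and by cdfs, and the normal value is subtracted. This links the Fourier estimate to the
  distance.\<close>

lemma gauss_functional_eq:
  assumes n: "1 \<le> n"
  shows "(LINT t|std_normal_distribution. sum_cf n t - exp (- t\<^sup>2 / 2))
    = (LINT x|lborel. x * exp (- x\<^sup>2 / 2) * (cdf (W n) x - std_normal_cdf x))"
proof -
  interpret W: real_distribution "W n" by (rule W_dist) fact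
  interpret N: real_distribution std_normal_distribution by (rule real_dist_normal_dist)
  have [measurable]: "cdf (W n) \<in> borel_measurable borel" "std_normal_cdf \<in> borel_measurable borel"
    by (auto intro!: borel_measurable_mono simp: mono_def W.cdf_nondecreasing N.cdf_nondecreasing std_normal_cdf_def)
  have b01: "0 \<le> std_normal_cdf x" "std_normal_cdf x \<le> 1" for x
    by (auto simp: N.cdf_nonneg N.cdf_bounded_prob std_normal_cdf_def)
  have "(LINT t|std_normal_distribution. sum_cf n t - exp (- t\<^sup>2 / 2))
    = (LINT t|std_normal_distribution. sum_cf n t) - (LINT t|std_normal_distribution. exp (- t\<^sup>2 / 2))"
    by (intro Bochner_Integration.integral_diff N.integrable_const_bound[of _ 1]) (auto simp: sum_cf_le_1)
  also have "\<dots> = (LINT z|W n. exp (- z\<^sup>2 / 2)) - (LINT z|std_normal_distribution. exp (- z\<^sup>2 / 2))"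
    by (simp only: W.expectation_gauss_eq_char[OF char_W[OF n]])
  also have "\<dots> = (LINT x|lborel. x * exp (- x\<^sup>2 / 2) * cdf (W n) x) - (LINT x|lborel. x * exp (- x\<^sup>2 / 2) * std_normal_cdf x)"
    by (simp only: W.expectation_gauss_eq_cdf N.expectation_gauss_eq_cdf std_normal_cdf_def)
  also have "\<dots> = (LINT x|lborel. x * exp (- x\<^sup>2 / 2) * cdf (W n) x - x * exp (- x\<^sup>2 / 2) * std_normal_cdf x)"
    by (intro Bochner_Integration.integral_diff[symmetric] Bochner_Integration.integrable_bound[OF integrable_ident_gauss])
      (auto simp: abs_mult W.cdf_nonneg W.cdf_bounded_prob b01 mult_left_le)
  finally show ?thesis by (simp add: right_diff_distrib)
qed

text \<open>The weighted distance bounds the cdf difference by a multiple of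
  \<open>(1 + \<bar>x\<bar>) powr m\<close>, which stays integrable against the Gaussian factor. The
  functional is therefore at most a constant times the distance.\<close>

lemma weighted_lower:
  assumes "poly_bounded_weight w"
  shows "\<exists>c>0. \<forall>n\<ge>1. c * real n powr (- ((\<alpha> - 2) / 2)) \<le> weighted_sup_dist w (cdf (W n)) std_normal_cdf"
proof -
  have w: "0 < w x \<and> w x \<le> 1" for x using assms unfolding poly_bounded_weight_def by blast
  obtain C m where C: "0 < C" and m: "\<And>x. inverse C * (1 + \<bar>x\<bar>) powr (- m) \<le> w x"
    using assms unfolding poly_bounded_weight_def by blast
  define J where "J = (LINT x|lborel. C * (\<bar>x\<bar> * exp (- x\<^sup>2 / 2) * (1 + \<bar>x\<bar>) powr m))"
  have J: "0 \<le> J" using C by (simp add: J_def)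
  have main: "(LINT t|std_normal_distribution. sum_cf n t - exp (- t\<^sup>2 / 2))
      \<le> weighted_sup_dist w (cdf (W n)) std_normal_cdf * (J + 1)" if n: "1 \<le> n" for n
  proof -
    let ?d = "weighted_sup_dist w (cdf (W n)) std_normal_cdf"
    interpret W: real_distribution "W n" by (rule W_dist) fact
    interpret N: real_distribution std_normal_distribution by (rule real_dist_normal_dist)
    have [measurable]: "cdf (W n) \<in> borel_measurable borel" "std_normal_cdf \<in> borel_measurable borel"
      by (auto intro!: borel_measurable_mono simp: mono_def W.cdf_nondecreasing N.cdf_nondecreasing std_normal_cdf_def)
    have d: "0 < ?d" by (rule weighted_sup_dist_pos[OF n w])
    have diff: "\<bar>cdf (W n) x - std_normal_cdf x\<bar> \<le> ?d * (C * (1 + \<bar>x\<bar>) powr m)" for x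
    proof -
      have "inverse C * (1 + \<bar>x\<bar>) powr (- m) * \<bar>cdf (W n) x - std_normal_cdf x\<bar> \<le> w x * \<bar>cdf (W n) x - std_normal_cdf x\<bar>"
        by (intro mult_right_mono m) auto
      also have "\<dots> \<le> ?d" by (rule weighted_diff_le[OF n w])
      finally show ?thesis using C by (simp add: powr_minus field_simps add_pos_nonneg)
    qed
    have "(LINT x|lborel. x * exp (- x\<^sup>2 / 2) * (cdf (W n) x - std_normal_cdf x))
      \<le> (LINT x|lborel. ?d * (C * (\<bar>x\<bar> * exp (- x\<^sup>2 / 2) * (1 + \<bar>x\<bar>) powr m)))"
    proof (rule integral_mono)
      show "integrable lborel (\<lambda>x. x * exp (- x\<^sup>2 / 2) * (cdf (W n) x - std_normal_cdf x))"
        by (rule Bochner_Integration.integrable_bound[OF integrable_ident_gauss])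
          (auto simp: abs_mult cdf_diff_le_1[OF n] mult_left_le)
      show "integrable lborel (\<lambda>x. ?d * (C * (\<bar>x\<bar> * exp (- x\<^sup>2 / 2) * (1 + \<bar>x\<bar>) powr m)))"
        by (intro integrable_mult_right integrable_powr_gauss)
      fix x :: real
      have "x * exp (- x\<^sup>2 / 2) * (cdf (W n) x - std_normal_cdf x)
          \<le> \<bar>x * exp (- x\<^sup>2 / 2) * (cdf (W n) x - std_normal_cdf x)\<bar>" by (rule abs_ge_self)
      also have "\<dots> = \<bar>x\<bar> * exp (- x\<^sup>2 / 2) * \<bar>cdf (W n) x - std_normal_cdf x\<bar>" by (simp add: abs_mult)
      also have "\<dots> \<le> \<bar>x\<bar> * exp (- x\<^sup>2 / 2) * (?d * (C * (1 + \<bar>x\<bar>) powr m))"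
        by (intro mult_left_mono diff) auto
      finally show "x * exp (- x\<^sup>2 / 2) * (cdf (W n) x - std_normal_cdf x)
          \<le> ?d * (C * (\<bar>x\<bar> * exp (- x\<^sup>2 / 2) * (1 + \<bar>x\<bar>) powr m))" by (simp add: mult_ac)
    qed
    also have "\<dots> = ?d * J" unfolding J_def by (rule Bochner_Integration.integral_mult_right_zero)
    \<comment> \<open>\<open>J + 1\<close> is a denominator known to be positive from
      \<open>0 \<le> J\<close> alone.\<close>
    also have "\<dots> \<le> ?d * (J + 1)" using d by simp
    finally show ?thesis unfolding gauss_functional_eq[OF n] .
  qed
  obtain c where c: "0 < c" and ev: "\<forall>\<^sub>F n in sequentially. c * real n powr (- (\<alpha> - 2) / 2)
       \<le> (LINT t|std_normal_distribution. sum_cf n t - exp (- t\<^sup>2 / 2))"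
    using sum_cf_gauss_lower by blast
  show ?thesis
  proof (rule positive_power_lower_bound)
    show "0 < c / (J + 1)" using c J by simp
    show "\<forall>\<^sub>F n in sequentially. c / (J + 1) * real n powr (- ((\<alpha> - 2) / 2)) \<le> weighted_sup_dist w (cdf (W n)) std_normal_cdf"
      using ev eventually_ge_at_top[of 1]
    proof eventually_elim
      case (elim n)
      have "c * real n powr (- ((\<alpha> - 2) / 2)) \<le> weighted_sup_dist w (cdf (W n)) std_normal_cdf * (J + 1)"
        using elim(1) main[OF elim(2)] unfolding minus_divide_left by (rule order_trans)
      then show ?case using J by (simp add: pos_divide_le_eq)
    qed
  qed (use alpha weighted_sup_dist_pos w in auto)
qed

lemma weighted_le_power:
  assumes "poly_bounded_weight w" "0 < s" "s < (\<alpha> - 2) / 2"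
  shows "\<exists>C. \<forall>n\<ge>1. weighted_sup_dist w (cdf (W n)) std_normal_cdf \<le> C * real n powr (- s)"
proof -
  have w: "0 < w x \<and> w x \<le> 1" for x using assms unfolding poly_bounded_weight_def by blast
  obtain C where C: "\<And>n. 1 \<le> n \<Longrightarrow> kolmogorov_dist (cdf (W n)) std_normal_cdf \<le> C * real n powr (- (2 * s) / 2)"
    using kolmogorov_upper[of "2 * s"] assms by auto
  have "weighted_sup_dist w (cdf (W n)) std_normal_cdf \<le> C * real n powr (- s)" if "1 \<le> n" for n
    using weighted_le_kolmogorov[OF that, of w, OF w] C[OF that] by simp
  then show ?thesis by blast
qed

lemma power_rate_weighted:
  assumes "poly_bounded_weight w"
  shows "power_rate (\<lambda>n. weighted_sup_dist w (cdf (W n)) std_normal_cdf) ((\<alpha> - 2) / 2)"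
  by (rule power_rateI[OF weighted_lower[OF assms] weighted_le_power[OF assms]]) (use alpha in auto)

lemma poly_bounded_weight_one: "poly_bounded_weight (\<lambda>_. 1)"
proof -
  have "\<forall>x::real. inverse (1::real) * (1 + \<bar>x\<bar>) powr (- 0) \<le> 1" by simp
  then show ?thesis unfolding poly_bounded_weight_def by (intro conjI allI) (auto intro!: exI[of _ "1::real"])
qed

lemma power_rate_kolmogorov:
  "power_rate (\<lambda>n. kolmogorov_dist (cdf (W n)) std_normal_cdf) ((\<alpha> - 2) / 2)"
  unfolding kolmogorov_dist_eq by (rule power_rate_weighted[OF poly_bounded_weight_one])

text \<open>Since \<open>\<alpha> < 3\<close>, the exponent \<open>(\<alpha> - 2) / 2\<close> is
  below \<open>1 / 2\<close>.\<close>

lemma not_bigo_weighted: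
  assumes "poly_bounded_weight w"
  shows "(\<lambda>n. weighted_sup_dist w (cdf (W n)) std_normal_cdf) \<notin> O(\<lambda>n. real n powr (- 1 / 2))"
  unfolding minus_divide_left[symmetric]
  by (rule not_bigo_of_power_lower_bound[OF weighted_lower[OF assms]]) (use alpha in simp)

lemma sandwich:
  assumes "poly_bounded_weight w" "0 < \<delta>" "\<delta> < \<alpha> - 2"
  shows "\<exists>c>0. \<exists>C. \<forall>n\<ge>1.
    c * real n powr (- (\<alpha> - 2) / 2) \<le> weighted_sup_dist w (cdf (W n)) std_normal_cdf \<and>
    weighted_sup_dist w (cdf (W n)) std_normal_cdf \<le> kolmogorov_dist (cdf (W n)) std_normal_cdf \<and>
    kolmogorov_dist (cdf (W n)) std_normal_cdf \<le> C * real n powr (- \<delta> / 2)"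
proof -
  have w: "0 < w x \<and> w x \<le> 1" for x using assms unfolding poly_bounded_weight_def by blast
  show ?thesis
proof -
    obtain c where c: "0 < c" "\<And>n. 1 \<le> n \<Longrightarrow> c * real n powr (- ((\<alpha> - 2) / 2)) \<le> weighted_sup_dist w (cdf (W n)) std_normal_cdf"
      using weighted_lower[OF assms(1)] by blast
    obtain C where C: "\<And>n. 1 \<le> n \<Longrightarrow> kolmogorov_dist (cdf (W n)) std_normal_cdf \<le> C * real n powr (- \<delta> / 2)"
      using kolmogorov_upper[OF assms(2,3)] by blast
    show ?thesis
      using c(1) c(2)[unfolded minus_divide_left] C weighted_le_kolmogorov[of _ w, OF _ w]
      by (intro exI[of _ c] exI[of _ C] conjI allI impI) auto
  qed
qed

end

section \<open>Standardized sums and the Student distribution\<close>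

lemma (in prob_space) char_standardized_sum:
  assumes indep: "indep_vars (\<lambda>_. borel) Xs {1..}" and D: "\<And>i. 1 \<le> i \<Longrightarrow> distr M borel (Xs i) = D"
  shows "char (distr M borel (standardized_sum 0 \<sigma> Xs n)) t = char D (t / (\<sigma> * sqrt (real n))) ^ n"
proof -
  let ?c = "1 / (\<sigma> * sqrt (real n))"
  have rv [measurable]: "Xs i \<in> borel_measurable M" if "1 \<le> i" for i
    using indep that unfolding indep_vars_def2 by auto
  have "standardized_sum 0 \<sigma> Xs n = (\<lambda>\<omega>. \<Sum>i\<in>{1..n}. ?c * Xs i \<omega>)"
    by (auto simp: standardized_sum_def sum_distrib_left)
  then have "char (distr M borel (standardized_sum 0 \<sigma> Xs n)) t
      = (\<Prod>i\<in>{1..n}. char (distr M borel (\<lambda>\<omega>. ?c * Xs i \<omega>)) t)"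
    using indep_vars_compose2[OF indep_vars_subset[OF indep, of "{1..n}"], of "\<lambda>_ x. ?c * x" "\<lambda>_. borel"]
    by (simp add: char_distr_sum)
  also have "\<dots> = (\<Prod>i\<in>{1..n}. char D (t / (\<sigma> * sqrt (real n))))"
  proof (rule prod.cong)
    fix i assume i: "i \<in> {1..n}"
    have "char (distr M borel (\<lambda>\<omega>. ?c * Xs i \<omega>)) t = char (distr M borel (Xs i)) (t / (\<sigma> * sqrt (real n)))"
      unfolding char_def using rv[of i] i by (simp add: integral_distr)
    then show "char (distr M borel (\<lambda>\<omega>. ?c * Xs i \<omega>)) t = char D (t / (\<sigma> * sqrt (real n)))"
      using D[of i] i by simp
  qed simp
  finally show ?thesis by simp
qed

text \<open>Transfer from random variables to laws: symmetry gives mean zero, hence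
  \<open>\<mu> = 0\<close> and the variance equals the second moment.\<close>

lemma heavy_tailed_sums_standardized:
  fixes P :: "'a measure" and M :: "'b measure" and Xs :: "nat \<Rightarrow> 'b \<Rightarrow> real"
  assumes P: "prob_space P" and X [measurable]: "X \<in> borel_measurable P"
    and M: "prob_space M" and indep: "prob_space.indep_vars M (\<lambda>_. borel) Xs {1..}"
    and eq: "\<forall>i\<ge>1. distr M borel (Xs i) = distr P borel X"
    and \<mu>: "\<mu> = prob_space.expectation M (Xs 1)"
    and \<sigma>: "\<sigma> = sqrt (prob_space.variance P X)"
    and symm: "symmetric_rv P X" and sq: "integrable P (\<lambda>\<omega>. (X \<omega>)\<^sup>2)"
    and var: "0 < prob_space.variance P X"
    and \<alpha>: "2 < \<alpha>" "\<alpha> < 3"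
    and low: "\<exists>c>0. \<exists>x0>0. \<forall>x\<ge>x0. c * x powr (- \<alpha>) \<le> measure P {\<omega> \<in> space P. x < \<bar>X \<omega>\<bar>}"
    and up: "\<exists>C. \<exists>x0>0. \<forall>x\<ge>x0. measure P {\<omega> \<in> space P. x < \<bar>X \<omega>\<bar>} \<le> C * x powr (- \<alpha>)"
  shows "heavy_tailed_sums (distr P borel X) (prob_space.variance P X) \<alpha>
    (\<lambda>n. distr M borel (standardized_sum \<mu> \<sigma> Xs n))"
proof -
  interpret P: prob_space P by fact
  interpret M: prob_space M by fact
  interpret D: real_distribution "distr P borel X" by simp
  have rv [measurable]: "Xs i \<in> borel_measurable M" if "1 \<le> i" for i
    using indep that unfolding M.indep_vars_def2 by auto
  have tail: "measure (distr P borel X) {y. x < \<bar>y\<bar>} = measure P {\<omega> \<in> space P. x < \<bar>X \<omega>\<bar>}" for x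
    by (subst measure_distr) (auto simp: vimage_def Int_def conj_commute)
  have "P.expectation X = (LINT x|distr P borel X. x)" by (simp add: integral_distr)
  also have "\<dots> = (LINT x|distr P borel (\<lambda>\<omega>. - X \<omega>). x)" using symm by (simp add: symmetric_rv_def)
  also have "\<dots> = - P.expectation X" by (simp add: integral_distr)
  finally have mean: "P.expectation X = 0" by simp
  interpret S: symmetric_distribution "distr P borel X" "P.variance X"
  proof
    show "distr (distr P borel X) borel uminus = distr P borel X"
      using symm by (simp add: symmetric_rv_def distr_distr comp_def)
  qed (use sq var in \<open>simp_all add: integrable_distr_eq integral_distr mean\<close>)
  interpret H: heavy_tailed_distribution "distr P borel X" "P.variance X" \<alpha>
    by standard (use \<alpha> low up in \<open>simp_all add: tail\<close>)
  have "M.expectation (Xs 1) = (LINT x|distr M borel (Xs 1). x)" by (simp add: integral_distr)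
  also have "\<dots> = P.expectation X" using eq by (simp add: integral_distr)
  finally have \<mu>0: "\<mu> = 0" by (simp add: \<mu> mean)
  show ?thesis
  proof (intro heavy_tailed_sums.intro heavy_tailed_sums_axioms.intro H.heavy_tailed_distribution_axioms)
    fix n :: nat
    have [measurable]: "standardized_sum \<mu> \<sigma> Xs n \<in> borel_measurable M"
      unfolding standardized_sum_def by (auto intro!: borel_measurable_times borel_measurable_sum borel_measurable_diff rv)
    show "real_distribution (distr M borel (standardized_sum \<mu> \<sigma> Xs n))" by simp
    show "char (distr M borel (standardized_sum \<mu> \<sigma> Xs n)) = (\<lambda>t. complex_of_real (H.sum_cf n t))"
    proof
      fix t
      have sqrt: "sqrt (P.variance X * real n) = \<sigma> * sqrt (real n)" unfolding \<sigma> by (rule real_sqrt_mult)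
      show "char (distr M borel (standardized_sum \<mu> \<sigma> Xs n)) t = complex_of_real (H.sum_cf n t)"
        unfolding H.sum_cf_def sqrt of_real_power S.char_eq_cf[symmetric] \<mu>0
        by (rule M.char_standardized_sum[OF indep]) (use eq in blast)
    qed
  qed
qed

text \<open>Once \<open>\<bar>\<epsilon> x\<bar> < 1 / 2\<close>, the factor
  \<open>1 + \<epsilon> x\<close> lies between \<open>1 / 2\<close> and \<open>2\<close>.\<close>

lemma tail_bounds_of_asymptotics:
  fixes g :: "real \<Rightarrow> real"
  assumes "0 < c0" and \<epsilon>: "(\<epsilon> \<longlongrightarrow> 0) at_top" and g: "\<forall>x>0. g x = c0 * x powr (- \<alpha>) * (1 + \<epsilon> x)"
  shows "\<exists>c>0. \<exists>x0>0. \<forall>x\<ge>x0. c * x powr (- \<alpha>) \<le> g x"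
    and "\<exists>C. \<exists>x0>0. \<forall>x\<ge>x0. g x \<le> C * x powr (- \<alpha>)"
proof -
  have "\<forall>\<^sub>F x in at_top. \<bar>\<epsilon> x\<bar> < 1 / 2" using tendstoD[OF \<epsilon>, of "1 / 2"] by (simp add: dist_real_def)
  then obtain N where N: "\<And>x. N \<le> x \<Longrightarrow> \<bar>\<epsilon> x\<bar> < 1 / 2" unfolding eventually_at_top_linorder by blast
  have b: "c0 / 2 * x powr (- \<alpha>) \<le> g x" "g x \<le> 2 * c0 * x powr (- \<alpha>)" if "max N 1 \<le> x" for x
  proof -
    have e: "\<bar>\<epsilon> x\<bar> < 1 / 2" "0 < x" using that N by auto
    have "c0 * x powr (- \<alpha>) * (1 / 2) \<le> c0 * x powr (- \<alpha>) * (1 + \<epsilon> x)"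
      "c0 * x powr (- \<alpha>) * (1 + \<epsilon> x) \<le> c0 * x powr (- \<alpha>) * 2"
      using e assms(1) by (auto intro!: mult_left_mono simp del: mult_le_cancel_left)
    then show "c0 / 2 * x powr (- \<alpha>) \<le> g x" "g x \<le> 2 * c0 * x powr (- \<alpha>)" using g e by auto
  qed
  show "\<exists>c>0. \<exists>x0>0. \<forall>x\<ge>x0. c * x powr (- \<alpha>) \<le> g x"
    using assms(1) b(1) by (intro exI[of _ "c0 / 2"] conjI exI[of _ "max N 1"]) auto
  show "\<exists>C. \<exists>x0>0. \<forall>x\<ge>x0. g x \<le> C * x powr (- \<alpha>)"
    using b(2) by (intro exI[of _ "2 * c0"] conjI exI[of _ "max N 1"]) auto
qed

section \<open>Tails and moments of the Student distribution\<close>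

lemma nn_integral_power_tail:
  assumes "0 < x" "1 < \<beta>" "0 \<le> c"
  shows "(\<integral>\<^sup>+y. ennreal (c * y powr (- \<beta>)) * indicator {x..} y \<partial>lborel) = ennreal (c / (\<beta> - 1) * x powr (- (\<beta> - 1)))"
proof -
  have "(\<integral>\<^sup>+y. ennreal (c * y powr (- \<beta>)) * indicator {x..} y \<partial>lborel)
      = ennreal (0 - (- (c / (\<beta> - 1)) * x powr (- (\<beta> - 1))))"
  proof (rule nn_integral_FTC_atLeast)
    fix y assume "x \<le> y"
    then have "((\<lambda>y. - (c / (\<beta> - 1)) * y powr (- (\<beta> - 1))) has_real_derivative
        - (c / (\<beta> - 1)) * (- (\<beta> - 1) * y powr (- (\<beta> - 1) - 1))) (at y)"
      using assms by (intro DERIV_cmult has_real_derivative_powr) auto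
    moreover have "- (c / (\<beta> - 1)) * (- (\<beta> - 1) * y powr (- (\<beta> - 1) - 1)) = c * y powr (- \<beta>)"
    proof -
      have cancel: "- (c / k) * (- k * z) = c * z" if "k \<noteq> 0" for k z :: real using that by simp
      have "- (\<beta> - 1) - 1 = - \<beta>" by simp
      then show ?thesis using cancel[of "\<beta> - 1" "y powr (- \<beta>)"] assms by simp
    qed
    ultimately show "((\<lambda>y. - (c / (\<beta> - 1)) * y powr (- (\<beta> - 1))) has_real_derivative c * y powr (- \<beta>)) (at y)"
      by (simp only:)
  next
    show "((\<lambda>y. - (c / (\<beta> - 1)) * y powr (- (\<beta> - 1))) \<longlongrightarrow> 0) at_top"
      using assms by real_asymp
  qed (use assms in auto)
  then show ?thesis by simp
qed

text \<open>For \<open>y \<ge> 1\<close> the base \<open>1 + y\<^sup>2 / \<nu>\<close> lies between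
  \<open>y\<^sup>2 / \<nu>\<close> and \<open>(1 + 1 / \<nu>) * y\<^sup>2\<close>; the negative
  exponent reverses the order.\<close>

lemma student_t_density_bounds:
  assumes "0 < \<nu>"
  obtains a b where "0 < a" "0 < b"
    "\<And>y. 1 \<le> y \<Longrightarrow> a * y powr (- (\<nu> + 1)) \<le> student_t_density \<nu> y"
    "\<And>y. 1 \<le> y \<Longrightarrow> student_t_density \<nu> y \<le> b * y powr (- (\<nu> + 1))"
proof -
  define K where "K = Gamma ((\<nu> + 1) / 2) / (sqrt (\<nu> * pi) * Gamma (\<nu> / 2))"
  have K: "0 < K" using assms by (auto simp: K_def intro!: divide_pos_pos mult_pos_pos Gamma_real_pos)
  have sq: "(k * y\<^sup>2) powr (- ((\<nu> + 1) / 2)) = k powr (- ((\<nu> + 1) / 2)) * y powr (- (\<nu> + 1))"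
    if "0 < k" "1 \<le> y" for k y :: real
  proof -
    have "y\<^sup>2 = y powr 2" using that by (subst powr_numeral) auto
    moreover have "2 * (- ((\<nu> + 1) / 2)) = - (\<nu> + 1)" by (simp add: field_simps)
    ultimately show ?thesis using that by (simp only: powr_mult powr_powr)
  qed
  have \<nu>1: "0 < 1 + 1 / \<nu>" and \<nu>2: "0 < 1 / \<nu>" using assms by (simp_all add: add_pos_pos)
  show thesis
  proof
    show "0 < K * (1 + 1 / \<nu>) powr (- ((\<nu> + 1) / 2))" "0 < K * (1 / \<nu>) powr (- ((\<nu> + 1) / 2))"
      using K assms \<nu>1 by (intro mult_pos_pos; simp)+
    fix y :: real assume y: "1 \<le> y"
    have y2: "1 \<le> y\<^sup>2" using y by simp
    have "((1 + 1 / \<nu>) * y\<^sup>2) powr (- ((\<nu> + 1) / 2)) \<le> (1 + y\<^sup>2 / \<nu>) powr (- ((\<nu> + 1) / 2))"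
      using assms y2 by (intro powr_mono2') (auto simp: algebra_simps intro!: add_pos_nonneg)
    then show "K * (1 + 1 / \<nu>) powr (- ((\<nu> + 1) / 2)) * y powr (- (\<nu> + 1)) \<le> student_t_density \<nu> y"
      unfolding student_t_density_def K_def[symmetric] sq[OF \<nu>1 y]
      using K by (simp add: mult.assoc)
    have "(1 + y\<^sup>2 / \<nu>) powr (- ((\<nu> + 1) / 2)) \<le> ((1 / \<nu>) * y\<^sup>2) powr (- ((\<nu> + 1) / 2))"
      using assms y2 y by (intro powr_mono2') auto
    then show "student_t_density \<nu> y \<le> K * (1 / \<nu>) powr (- ((\<nu> + 1) / 2)) * y powr (- (\<nu> + 1))"
      unfolding student_t_density_def K_def[symmetric] sq[OF \<nu>2 y]
      using K by (simp add: mult.assoc)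
  qed
qed

text \<open>Evenness of the density gives symmetry, and integrating its power bounds gives the
  tails. The second moment is finite because the tail exponent \<open>\<nu>\<close> exceeds
  \<open>2\<close>.\<close>

lemma student_t_properties:
  fixes P :: "'a measure"
  assumes P: "prob_space P" and X: "distributed P lborel X (\<lambda>x. ennreal (student_t_density \<nu> x))"
    and \<nu>: "2 < \<nu>"
  shows "symmetric_rv P X" and "integrable P (\<lambda>\<omega>. (X \<omega>)\<^sup>2)" and "0 < prob_space.variance P X"
    and "\<exists>c>0. \<exists>x0>0. \<forall>x\<ge>x0. c * x powr (- \<nu>) \<le> measure P {\<omega> \<in> space P. x < \<bar>X \<omega>\<bar>}"
    and "\<exists>C. \<exists>x0>0. \<forall>x\<ge>x0. measure P {\<omega> \<in> space P. x < \<bar>X \<omega>\<bar>} \<le> C * x powr (- \<nu>)"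
proof -
  interpret P: prob_space P by fact
  let ?f = "student_t_density \<nu>"
  have X_rv [measurable]: "X \<in> borel_measurable P" using distributed_measurable[OF X] by simp
  define D where "D = distr P borel X"
  interpret D: real_distribution D unfolding D_def by simp
  have f [measurable]: "?f \<in> borel_measurable borel" unfolding student_t_density_def by measurable
  have "D = distr P lborel X" unfolding D_def by (rule distr_cong) auto
  also have "\<dots> = density lborel (\<lambda>x. ennreal (?f x))" by (rule distributed_distr_eq_density[OF X])
  finally have Dd: "D = density lborel (\<lambda>x. ennreal (?f x))" .
  have even: "?f (- x) = ?f x" for x by (simp add: student_t_density_def)
  have Dsym: "distr D borel uminus = D"
  proof -
    have "D = density (distr lborel borel uminus) (\<lambda>x. ennreal (?f x))" by (simp add: Dd lborel_distr_uminus)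
    also have "\<dots> = distr (density lborel (\<lambda>x. ennreal (?f (- x)))) borel uminus"
      by (rule density_distr) auto
    also have "\<dots> = distr D borel uminus" by (simp add: even Dd)
    finally show ?thesis by simp
  qed
  show symm: "symmetric_rv P X"
    using Dsym by (simp add: symmetric_rv_def D_def distr_distr comp_def)
  have tail: "measure D {y. x < \<bar>y\<bar>} = measure P {\<omega> \<in> space P. x < \<bar>X \<omega>\<bar>}" for x
    unfolding D_def by (subst measure_distr) (auto simp: vimage_def Int_def conj_commute)
  obtain a b where a: "0 < a" and b: "0 < b"
    and fa: "\<And>y. 1 \<le> y \<Longrightarrow> a * y powr (- (\<nu> + 1)) \<le> ?f y"
    and fb: "\<And>y. 1 \<le> y \<Longrightarrow> ?f y \<le> b * y powr (- (\<nu> + 1))"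
    using student_t_density_bounds[of \<nu>] \<nu> by auto
  have half: "emeasure D {x..} = (\<integral>\<^sup>+y. ennreal (?f y) * indicator {x..} y \<partial>lborel)" for x
    unfolding Dd by (rule emeasure_density) auto
  have low: "a / \<nu> * x powr (- \<nu>) \<le> measure D {x..}" if "1 \<le> x" for x
  proof -
    have "ennreal (a / \<nu> * x powr (- \<nu>)) = (\<integral>\<^sup>+y. ennreal (a * y powr (- (\<nu> + 1))) * indicator {x..} y \<partial>lborel)"
      using nn_integral_power_tail[of x "\<nu> + 1" a] that \<nu> a by simp
    also have "\<dots> \<le> emeasure D {x..}" unfolding half
      by (intro nn_integral_mono) (use that fa in \<open>auto simp: indicator_def intro!: ennreal_leI\<close>)
    finally show ?thesis by (simp add: D.emeasure_eq_measure)
  qed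
  have up: "measure D {x..} \<le> b / \<nu> * x powr (- \<nu>)" if "1 \<le> x" for x
  proof -
    have "emeasure D {x..} \<le> (\<integral>\<^sup>+y. ennreal (b * y powr (- (\<nu> + 1))) * indicator {x..} y \<partial>lborel)" unfolding half
      by (intro nn_integral_mono) (use that fb in \<open>auto simp: indicator_def intro!: ennreal_leI\<close>)
    also have "\<dots> = ennreal (b / \<nu> * x powr (- \<nu>))"
      using nn_integral_power_tail[of x "\<nu> + 1" b] that \<nu> b by simp
    finally show ?thesis using b \<nu> by (simp add: D.emeasure_eq_measure)
  qed
  have "measure D {..- x} = measure (distr D borel uminus) {..- x}" for x by (simp only: Dsym)
  also have "measure (distr D borel uminus) {..- x} = measure D {x..}" for x
    by (subst measure_distr) (auto intro!: arg_cong[where f = "measure D"])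
  finally have left: "measure D {..- x} = measure D {x..}" for x .
  have Dup: "measure D {y. x < \<bar>y\<bar>} \<le> 2 * b / \<nu> * x powr (- \<nu>)" if "1 \<le> x" for x
  proof -
    have "measure D {y. x < \<bar>y\<bar>} \<le> measure D ({..- x} \<union> {x..})" by (rule D.finite_measure_mono) auto
    also have "\<dots> \<le> measure D {..- x} + measure D {x..}" by (rule measure_Un_le) auto
    finally show ?thesis using up[OF that] by (simp add: left)
  qed
  \<comment> \<open>Doubling the threshold fits the closed half-line \<open>{2 * x..}\<close> into
    the strict event.\<close>
  have Dlow: "a / \<nu> * 2 powr (- \<nu>) * x powr (- \<nu>) \<le> measure D {y. x < \<bar>y\<bar>}" if "1 \<le> x" for x
  proof -
    have "a / \<nu> * 2 powr (- \<nu>) * x powr (- \<nu>) = a / \<nu> * (2 * x) powr (- \<nu>)" using that by (simp add: powr_mult)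
    also have "\<dots> \<le> measure D {2 * x..}" by (rule low) (use that in simp)
    also have "\<dots> \<le> measure D {y. x < \<bar>y\<bar>}" by (rule D.finite_measure_mono) (use that in auto)
    finally show ?thesis .
  qed
  have a': "0 < a / \<nu> * 2 powr (- \<nu>)" using a \<nu> by simp
  show "\<exists>c>0. \<exists>x0>0. \<forall>x\<ge>x0. c * x powr (- \<nu>) \<le> measure P {\<omega> \<in> space P. x < \<bar>X \<omega>\<bar>}"
    unfolding tail[symmetric] using a' Dlow zero_less_one by blast
  have U: "\<exists>C. \<exists>x0>0. \<forall>x\<ge>x0. measure D {y. x < \<bar>y\<bar>} \<le> C * x powr (- \<nu>)"
    using Dup zero_less_one by blast
  then show "\<exists>C. \<exists>x0>0. \<forall>x\<ge>x0. measure P {\<omega> \<in> space P. x < \<bar>X \<omega>\<bar>} \<le> C * x powr (- \<nu>)"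
    unfolding tail .
  have "integrable D (\<lambda>x. \<bar>x\<bar> powr 2)" by (rule D.integrable_abs_powr[OF _ \<nu> U]) simp
  moreover have "\<bar>x\<bar> powr 2 = x\<^sup>2" for x :: real by (cases "x = 0") (auto simp: powr_numeral)
  ultimately have D2: "integrable D (\<lambda>x. x\<^sup>2)" by (simp only:)
  then show "integrable P (\<lambda>\<omega>. (X \<omega>)\<^sup>2)" unfolding D_def by (simp add: integrable_distr_eq)
  have "P.expectation X = (LINT x|D. x)" by (simp add: integral_distr D_def)
  also have "\<dots> = (LINT x|distr D borel uminus. x)" by (simp only: Dsym)
  also have "\<dots> = - P.expectation X" by (simp add: integral_distr D_def)
  finally have mean: "P.expectation X = 0" by simp
  \<comment> \<open>Markov's inequality: the second moment is at least the probability of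
    \<open>1 < \<bar>y\<bar>\<close>, which the lower tail bound makes positive.\<close>
  have "0 < measure D {y. 1 < \<bar>y\<bar>}" using Dlow[of 1] a' by simp
  also have "\<dots> = (LINT x|D. indicator {y. 1 < \<bar>y\<bar>} x)" by simp
  also have "\<dots> \<le> (LINT x|D. x\<^sup>2)"
  proof (rule integral_mono[OF _ D2])
    show "integrable D (indicat_real {y. 1 < \<bar>y\<bar>})" by (rule D.integrable_const_bound[of _ 1]) auto
    show "indicat_real {y. 1 < \<bar>y\<bar>} x \<le> x\<^sup>2" for x
      using abs_le_square_iff[of 1 x] by (auto simp: indicator_def)
  qed
  also have "\<dots> = P.variance X" by (simp add: mean D_def integral_distr)
  finally show "0 < P.variance X" .
qed

theorem corollary3p6:
  fixes P :: "'a measure" and X :: "'a \<Rightarrow> real"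
    and M :: "'b measure" and Xs :: "nat \<Rightarrow> 'b \<Rightarrow> real"
    and \<mu> \<sigma> :: real and F :: "nat \<Rightarrow> real \<Rightarrow> real" and h :: "real \<Rightarrow> real"
  assumes "prob_space P" and "X \<in> borel_measurable P"
    and "prob_space M" and "prob_space.indep_vars M (\<lambda>_. borel) Xs {1..}"
    and "\<forall>i\<ge>1. distr M borel (Xs i) = distr P borel X"
    and "\<mu> = prob_space.expectation M (Xs 1)"
    and "\<sigma> = sqrt (prob_space.variance P X)"
    and "F = (\<lambda>n. cdf (distr M borel (standardized_sum \<mu> \<sigma> Xs n)))"
    and "regular_exhaustion h"
  shows
    "(\<forall>\<alpha> c0 \<epsilon>.
        symmetric_rv P X \<and> integrable P (\<lambda>\<omega>. (X \<omega>)\<^sup>2) \<and> 0 < prob_space.variance P X \<and>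
        2 < \<alpha> \<and> \<alpha> < 3 \<and> 0 < c0 \<and> (\<epsilon> \<longlongrightarrow> 0) at_top \<and>
        (\<forall>x>0. measure P {\<omega> \<in> space P. \<bar>X \<omega>\<bar> > x} = c0 * x powr (- \<alpha>) * (1 + \<epsilon> x))
      \<longrightarrow>
        (\<forall>q>0. \<forall>\<delta>. 0 < \<delta> \<and> \<delta> < \<alpha> - 2 \<longrightarrow>
          (\<exists>c>0. \<exists>C. \<forall>n\<ge>1.
             c * real n powr (- (\<alpha> - 2) / 2) \<le> weighted_kolmogorov_dist h q (F n) std_normal_cdf \<and>
             weighted_kolmogorov_dist h q (F n) std_normal_cdf
               \<le> kolmogorov_dist (F n) std_normal_cdf \<and>
             kolmogorov_dist (F n) std_normal_cdf \<le> C * real n powr (- \<delta> / 2))) \<and>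
        (\<forall>q>0. power_rate (\<lambda>n. weighted_kolmogorov_dist h q (F n) std_normal_cdf) ((\<alpha> - 2) / 2)) \<and>
        power_rate (\<lambda>n. kolmogorov_dist (F n) std_normal_cdf) ((\<alpha> - 2) / 2) \<and>
        (\<forall>h' q. regular_exhaustion h' \<and> 0 < q \<longrightarrow>
          (\<lambda>n. weighted_kolmogorov_dist h' q (F n) std_normal_cdf)
            \<notin> O(\<lambda>n. real n powr (- 1 / 2))) \<and>
        (\<forall>w. poly_bounded_weight w \<longrightarrow>
          (\<lambda>n. weighted_sup_dist w (F n) std_normal_cdf) \<notin> O(\<lambda>n. real n powr (- 1 / 2))))
     \<and>
     (distributed P lborel X (\<lambda>x. ennreal (student_t_density (5 / 2) x)) \<longrightarrow>
        (\<forall>q>0. power_rate (\<lambda>n. weighted_kolmogorov_dist h q (F n) std_normal_cdf) (1 / 4)) \<and>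
        power_rate (\<lambda>n. kolmogorov_dist (F n) std_normal_cdf) (1 / 4))"
proof (rule conjI, goal_cases)
  case 1
  show ?case
  proof (intro allI impI, elim conjE)
    fix \<alpha> c0 :: real and \<epsilon> :: "real \<Rightarrow> real"
    assume X: "symmetric_rv P X" "integrable P (\<lambda>\<omega>. (X \<omega>)\<^sup>2)" "0 < prob_space.variance P X"
      and \<alpha>: "2 < \<alpha>" "\<alpha> < 3" and c0: "0 < c0" "(\<epsilon> \<longlongrightarrow> 0) at_top"
        "\<forall>x>0. measure P {\<omega> \<in> space P. \<bar>X \<omega>\<bar> > x} = c0 * x powr (- \<alpha>) * (1 + \<epsilon> x)"
    interpret S: heavy_tailed_sums "distr P borel X" "prob_space.variance P X" \<alpha>
        "\<lambda>n. distr M borel (standardized_sum \<mu> \<sigma> Xs n)"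
      by (rule heavy_tailed_sums_standardized[OF assms(1-7) X \<alpha> tail_bounds_of_asymptotics[OF c0]])
    note w = regular_exhaustion_weight[OF \<open>regular_exhaustion h\<close>]
    show "(\<forall>q>0. \<forall>\<delta>. 0 < \<delta> \<and> \<delta> < \<alpha> - 2 \<longrightarrow>
          (\<exists>c>0. \<exists>C. \<forall>n\<ge>1.
             c * real n powr (- (\<alpha> - 2) / 2) \<le> weighted_kolmogorov_dist h q (F n) std_normal_cdf \<and>
             weighted_kolmogorov_dist h q (F n) std_normal_cdf
               \<le> kolmogorov_dist (F n) std_normal_cdf \<and>
             kolmogorov_dist (F n) std_normal_cdf \<le> C * real n powr (- \<delta> / 2))) \<and>
        (\<forall>q>0. power_rate (\<lambda>n. weighted_kolmogorov_dist h q (F n) std_normal_cdf) ((\<alpha> - 2) / 2)) \<and>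
        power_rate (\<lambda>n. kolmogorov_dist (F n) std_normal_cdf) ((\<alpha> - 2) / 2) \<and>
        (\<forall>h' q. regular_exhaustion h' \<and> 0 < q \<longrightarrow>
          (\<lambda>n. weighted_kolmogorov_dist h' q (F n) std_normal_cdf)
            \<notin> O(\<lambda>n. real n powr (- 1 / 2))) \<and>
        (\<forall>w. poly_bounded_weight w \<longrightarrow>
          (\<lambda>n. weighted_sup_dist w (F n) std_normal_cdf) \<notin> O(\<lambda>n. real n powr (- 1 / 2)))"
      unfolding \<open>F = _\<close> weighted_kolmogorov_dist_def
      by (intro conjI allI impI S.sandwich S.power_rate_weighted S.power_rate_kolmogorov S.not_bigo_weighted w
        regular_exhaustion_weight) auto
  qed
next
  case 2
  show ?case
  proof
    assume t: "distributed P lborel X (\<lambda>x. ennreal (student_t_density (5 / 2) x))"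
    \<comment> \<open>The degrees of freedom are the tail exponent, so the rate
      \<open>(\<alpha> - 2) / 2\<close> becomes \<open>1 / 4\<close>. The tail bounds come from the
      density, not from an exact asymptotic.\<close>
    interpret S: heavy_tailed_sums "distr P borel X" "prob_space.variance P X" "5 / 2"
        "\<lambda>n. distr M borel (standardized_sum \<mu> \<sigma> Xs n)"
      by (rule heavy_tailed_sums_standardized[OF assms(1-7) student_t_properties(1-3)[OF assms(1) t] _ _
          student_t_properties(4-5)[OF assms(1) t]]) auto
    show "(\<forall>q>0. power_rate (\<lambda>n. weighted_kolmogorov_dist h q (F n) std_normal_cdf) (1 / 4)) \<and>
        power_rate (\<lambda>n. kolmogorov_dist (F n) std_normal_cdf) (1 / 4)"
      using S.power_rate_weighted[OF regular_exhaustion_weight[OF \<open>regular_exhaustion h\<close>]] S.power_rate_kolmogorov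
      unfolding \<open>F = _\<close> weighted_kolmogorov_dist_def by simp
  qed
qed

end
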